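(* Let $\varepsilon>0$ and let $X=(X_t)_{t\in[0,1]}$ be a (nondeterministic) $(\nu,\sigma^2)$-Lévy martingale with $\nu$ supported on $[-\varepsilon,\varepsilon]$. Then $$\mathbb{P}(\|X\|\le3\varepsilon)\ge e^{-10F(\varepsilon)-3}\qquad\text{and}\qquad \mathbb{P}(\|X\|\le\varepsilon/2)\le e^{-F(\varepsilon)/12+1},$$ where $$F(\varepsilon):=\frac1{\varepsilon^2}\left[\sigma^2+\int_{[-\varepsilon,\varepsilon]\setminus\{0\}}x^2\,\nu(dx)\right].$$
   Context: $\|X\|:=\sup_{t\in[0,1]}|X_t|$. A Lévy process $X$ has independent stationary increments, $X_0=0$, is stochastically continuous and has càdlàg paths. For $\sigma^2\ge0$ and a positive measure $\nu$ on $\mathbb{R}\setminus\{0\}$ with $\int|x|\wedge x^2\,\nu(dx)<\infty$, a $(\nu,\sigma^2)$-Lévy martingale is a real-valued Lévy process with $\mathbb{E}e^{iuX_t}=e^{-t\psi(u)}$, where $\psi(u)=\frac{\sigma^2}{2}u^2+\int_{\mathbb{R}\setminus\{0\}}(1-e^{iux}+iux)\,\nu(dx)$. *)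

theory Defs
  imports "HOL-Probability.Probability"
begin

definition cadlag_on_unit :: "(real \<Rightarrow> real) \<Rightarrow> bool" where
  "cadlag_on_unit f \<longleftrightarrow>
     (\<forall>t\<in>{0..<1}. (f \<longlongrightarrow> f t) (at_right t)) \<and>
     (\<forall>t\<in>{0<..1}. \<exists>l. (f \<longlongrightarrow> l) (at_left t))"

text \<open>The value is meaningful because a cadlag path is bounded on the unit interval.\<close>

definition unit_sup_norm :: "(real \<Rightarrow> real) \<Rightarrow> real" where
  "unit_sup_norm f = (SUP t\<in>{0..1}. \<bar>f t\<bar>)"

text \<open>Processes are indexed by \<^term>\<open>{0..1::real}\<close>; the values of \<^term>\<open>X\<close> at other times are
  irrelevant.\<close>

locale levy_process = prob_space M
  for M :: "'a measure" +
  fixes X :: "real \<Rightarrow> 'a \<Rightarrow> real"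
  assumes random_variable_X: "\<And>t. t \<in> {0..1} \<Longrightarrow> X t \<in> borel_measurable M"
    and start_zero: "\<And>\<omega>. \<omega> \<in> space M \<Longrightarrow> X 0 \<omega> = 0"
    and indep_increments:
      "\<And>n t. 0 \<le> t 0 \<Longrightarrow> \<forall>i<n. t i < t (Suc i) \<Longrightarrow> t n \<le> 1 \<Longrightarrow>
         indep_vars (\<lambda>_. borel) (\<lambda>i \<omega>. X (t (Suc i)) \<omega> - X (t i) \<omega>) {..<n}"
    and stationary_increments:
      "\<And>s t h. 0 \<le> s \<Longrightarrow> 0 \<le> t \<Longrightarrow> 0 \<le> h \<Longrightarrow> s + h \<le> 1 \<Longrightarrow> t + h \<le> 1 \<Longrightarrow>
         distr M borel (\<lambda>\<omega>. X (s + h) \<omega> - X s \<omega>) =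
         distr M borel (\<lambda>\<omega>. X (t + h) \<omega> - X t \<omega>)"
    and stochastically_continuous:
      "\<And>t \<delta>. t \<in> {0..1} \<Longrightarrow> \<delta> > 0 \<Longrightarrow>
         ((\<lambda>s. prob {\<omega> \<in> space M. \<bar>X s \<omega> - X t \<omega>\<bar> > \<delta>}) \<longlongrightarrow> 0) (at t within {0..1})"
    and cadlag_paths: "\<And>\<omega>. \<omega> \<in> space M \<Longrightarrow> cadlag_on_unit (\<lambda>t. X t \<omega>)"

definition levy_exponent :: "real measure \<Rightarrow> real \<Rightarrow> real \<Rightarrow> complex" where
  "levy_exponent \<nu> \<sigma>2 u =
     of_real (\<sigma>2 / 2 * u\<^sup>2) +
     (LINT x:(- {0})|\<nu>. 1 - exp (\<i> * of_real (u * x)) + \<i> * of_real (u * x))"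

text \<open>A measure on the punctured line is encoded as a Borel measure on the line without an atom
  at the origin. The variable \<open>\<sigma>2\<close> stands for the variance $\sigma^2$ itself.\<close>

locale levy_martingale = levy_process M X
  for M :: "'a measure" and X :: "real \<Rightarrow> 'a \<Rightarrow> real" +
  fixes \<nu> :: "real measure" and \<sigma>2 :: real
  assumes sigma2_nonneg: "0 \<le> \<sigma>2"
    and sets_nu: "sets \<nu> = sets borel"
    and nu_zero: "emeasure \<nu> {0} = 0"
    and nu_integrable: "(\<integral>\<^sup>+ x. ennreal (min \<bar>x\<bar> (x\<^sup>2)) \<partial>\<nu>) < \<infinity>"
    and char_exponent:
      "\<And>t u. t \<in> {0..1} \<Longrightarrow>
         expectation (\<lambda>\<omega>. exp (\<i> * of_real (u * X t \<omega>))) =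
         exp (- of_real t * levy_exponent \<nu> \<sigma>2 u)"

definition deterministic :: "'a measure \<Rightarrow> (real \<Rightarrow> 'a \<Rightarrow> real) \<Rightarrow> bool" where
  "deterministic M X \<longleftrightarrow> (\<exists>f. \<forall>t\<in>{0..1}. AE \<omega> in M. X t \<omega> = f t)"

definition levy_F :: "real measure \<Rightarrow> real \<Rightarrow> real \<Rightarrow> real" where
  "levy_F \<nu> \<sigma>2 \<epsilon> = 1 / \<epsilon>\<^sup>2 * (\<sigma>2 + (LINT x:({-\<epsilon>..\<epsilon>} - {0})|\<nu>. x\<^sup>2))"

end

theory Submission
  imports Defs
begin

text \<open>
  Sample \<open>X\<close> at the times \<open>k / n\<close> and write \<open>S\<^sub>k\<close> for the resulting random walk. For a trigonometric test
  function \<open>h(x) = c + cos (u x)\<close>, the conditional expectation of \<open>h(S\<^sub>k\<^sub>+\<^sub>1)\<close> given the past is an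
  explicit expression in \<open>S\<^sub>k\<close> and \<open>exp (- \<psi>(u) / n)\<close>, so neither stopping times nor the
  jumps of the paths are needed.
  With \<open>c = 1\<close> and \<open>u = 1 / \<epsilon>\<close>, \<open>h\<close> is nonnegative and contracts by \<open>1 - F / (12 n)\<close> in each step as
  long as the walk stays in \<open>[-\<epsilon> / 2, \<epsilon> / 2]\<close>; this gives the upper bound.
  With \<open>c = 1 / 2\<close> and \<open>u = 2 \<pi> / (9 \<epsilon>)\<close>, \<open>h\<close> is positive exactly on \<open>(-3 \<epsilon>, 3 \<epsilon>)\<close>
  within \<open>[-6 \<epsilon>, 6 \<epsilon>]\<close>, and restricted to paths that stay in \<open>[-3 \<epsilon>, 3 \<epsilon>]\<close> it loses at most a factor
  \<open>1 - F / n\<close> per step. Here steps larger than \<open>3 \<epsilon>\<close> must be discarded; their probability is at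
  most about \<open>F / (81 n)\<close> by Markov's inequality for the fourth moment, which is read off the fourth
  difference of the characteristic function. Finally \<open>n = 2 ^ m\<close> tends to infinity.
\<close>

section \<open>Elementary estimates\<close>

text \<open>First-order Taylor remainder of \<open>iexp\<close>. The quadratic bound is what reduces
  integrals against \<open>\<nu>\<close> to the second moment.\<close>

lemma norm_one_minus_iexp_le:
  fixes y :: real
  shows "cmod (1 - exp (\<i> * of_real y) + \<i> * of_real y) \<le> y\<^sup>2 / 2"
proof -
  have "norm (iexp y - (\<Sum>k\<le>1. (\<i> * y) ^ k / fact k)) \<le> y\<^sup>2 / 2"
    using iexp_approx1[of y 1] by (simp add: eval_nat_numeral)
  moreover have "iexp y - (\<Sum>k\<le>1. (\<i> * y) ^ k / fact k)
      = - (1 - exp (\<i> * of_real y) + \<i> * of_real y)"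
    by (simp add: algebra_simps)
  ultimately show ?thesis by (simp only: norm_minus_cancel)
qed

text \<open>Imaginary part of the second-order remainder of \<open>iexp\<close>, whose quadratic
  term is real; the next lemma takes the real part at third order, where the cubic term is
  imaginary.\<close>

lemma abs_diff_sin_le:
  fixes y :: real
  shows "\<bar>y - sin y\<bar> \<le> \<bar>y\<bar> ^ 3 / 6"
proof -
  have "\<bar>Im (iexp y - (\<Sum>k\<le>2. (\<i> * y) ^ k / fact k))\<bar> \<le> \<bar>y\<bar> ^ 3 / 6"
    using order_trans[OF abs_Im_le_cmod iexp_approx1[of y 2]]
    by (simp add: fact_numeral eval_nat_numeral)
  moreover have "Im (iexp y - (\<Sum>k\<le>2. (\<i> * y) ^ k / fact k)) = sin y - y"
    by (simp add: eval_nat_numeral Im_exp)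
  ultimately show ?thesis by (simp add: abs_minus_commute)
qed

lemma one_minus_cos_ge:
  fixes y :: real
  shows "y\<^sup>2 / 2 - y ^ 4 / 24 \<le> 1 - cos y"
proof -
  have "\<bar>Re (iexp y - (\<Sum>k\<le>3. (\<i> * y) ^ k / fact k))\<bar> \<le> y ^ 4 / 24"
    using order_trans[OF abs_Re_le_cmod iexp_approx1[of y 3]]
    by (simp add: fact_numeral eval_nat_numeral)
  moreover have "Re (iexp y - (\<Sum>k\<le>3. (\<i> * y) ^ k / fact k)) = cos y - 1 + y\<^sup>2 / 2"
    by (simp add: eval_nat_numeral Re_exp)
  ultimately show ?thesis by (simp add: abs_if split: if_splits)
qed

lemma one_minus_cos_le:
  fixes y :: real
  shows "1 - cos y \<le> y\<^sup>2 / 2"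
  using order_trans[OF complex_Re_le_cmod norm_one_minus_iexp_le[of y]] by (simp add: Re_exp)

text \<open>This is \<open>(2 sin (y / 2)) ^ 4\<close>, the fourth central difference at the origin of \<open>v \<mapsto> cos (v y)\<close>.\<close>

lemma cos_fourth_difference:
  fixes y :: real
  shows "6 - 8 * cos y + 2 * cos (2 * y) = 4 * (1 - cos y)\<^sup>2"
  unfolding cos_double_cos by (simp add: power2_eq_square algebra_simps)

text \<open>Linearises the characteristic function of a short step up to a second-order error. The 3
  bounds \<open>exp 1\<close>.\<close>

lemma norm_exp_minus_linear_le:
  fixes z :: complex
  assumes "norm z \<le> 1"
  shows "norm (exp z - 1 - z) \<le> 3 * (norm z)\<^sup>2"
proof -
  have "norm (exp z - 1 - z) \<le> exp \<bar>Re z\<bar> * (norm z)\<^sup>2"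
    using Taylor_exp[of z 1] by (simp add: eval_nat_numeral algebra_simps)
  also have "\<dots> \<le> exp 1 * (norm z)\<^sup>2"
    using abs_Re_le_cmod[of z] assms by (intro mult_right_mono) auto
  also have "\<dots> \<le> 3 * (norm z)\<^sup>2"
    using exp_le by (intro mult_right_mono) auto
  finally show ?thesis .
qed

text \<open>Exhibits \<open>x ^ 4\<close> as a limit of rescaled fourth differences of bounded
  functions, so that Fatou's lemma can reach the fourth moment before it is known to be finite. The
  square root is squeezed first, then squared.\<close>

lemma scaled_cos_tendsto:
  fixes x :: real
  shows "(\<lambda>m. 4 * (1 - cos (x / real (Suc m)))\<^sup>2 * real (Suc m) ^ 4) \<longlonglongrightarrow> x ^ 4"
proof -
  let ?N = "\<lambda>m. real (Suc m)"
  have "(\<lambda>m. 2 * (1 - cos (x / ?N m)) * (?N m)\<^sup>2) \<longlonglongrightarrow> x\<^sup>2"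
  proof (rule tendsto_sandwich)
    have "(\<lambda>m. x\<^sup>2 - x ^ 4 / 12 * (inverse (?N m))\<^sup>2) \<longlonglongrightarrow> x\<^sup>2 - x ^ 4 / 12 * 0\<^sup>2"
      by (intro tendsto_intros LIMSEQ_inverse_real_of_nat)
    then show "(\<lambda>m. x\<^sup>2 - x ^ 4 / 12 * (inverse (?N m))\<^sup>2) \<longlonglongrightarrow> x\<^sup>2" by simp
    show "\<forall>\<^sub>F m in sequentially. x\<^sup>2 - x ^ 4 / 12 * (inverse (?N m))\<^sup>2 \<le> 2 * (1 - cos (x / ?N m)) * (?N m)\<^sup>2"
    proof (intro always_eventually allI)
      fix m
      have "2 * ((x / ?N m)\<^sup>2 / 2 - (x / ?N m) ^ 4 / 24) * (?N m)\<^sup>2 \<le> 2 * (1 - cos (x / ?N m)) * (?N m)\<^sup>2"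
        using one_minus_cos_ge[of "x / ?N m"] by (intro mult_right_mono mult_left_mono) auto
      moreover have "2 * ((x / N)\<^sup>2 / 2 - (x / N) ^ 4 / 24) * N\<^sup>2 = x\<^sup>2 - x ^ 4 / 12 * (inverse N)\<^sup>2"
        if "N \<noteq> 0" for N :: real
        using that by (simp add: field_simps eval_nat_numeral)
      ultimately show "x\<^sup>2 - x ^ 4 / 12 * (inverse (?N m))\<^sup>2 \<le> 2 * (1 - cos (x / ?N m)) * (?N m)\<^sup>2"
        by (metis of_nat_neq_0)
    qed
    show "\<forall>\<^sub>F m in sequentially. 2 * (1 - cos (x / ?N m)) * (?N m)\<^sup>2 \<le> x\<^sup>2"
    proof (intro always_eventually allI)
      fix m
      have "2 * (1 - cos (x / ?N m)) * (?N m)\<^sup>2 \<le> 2 * ((x / ?N m)\<^sup>2 / 2) * (?N m)\<^sup>2"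
        using one_minus_cos_le[of "x / ?N m"] by (intro mult_right_mono mult_left_mono) auto
      then show "2 * (1 - cos (x / ?N m)) * (?N m)\<^sup>2 \<le> x\<^sup>2"
        by (simp add: power_divide)
    qed
  qed simp
  then have "(\<lambda>m. (2 * (1 - cos (x / ?N m)) * (?N m)\<^sup>2)\<^sup>2) \<longlonglongrightarrow> (x\<^sup>2)\<^sup>2"
    by (rule tendsto_power)
  moreover have "(2 * (1 - c) * N\<^sup>2)\<^sup>2 = 4 * (1 - c)\<^sup>2 * N ^ 4" for c N :: real
    unfolding power_mult_distrib by (simp flip: power_mult)
  ultimately show ?thesis by (simp only: flip: power_mult) simp
qed

text \<open>A shift by \<pi> turns this into \<open>cos \<ge> 1 / 2\<close> within
  \<open>pi / 3\<close> of the origin. These are the angles reached by a walk that leaves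
  \<open>[-b, b]\<close> by a step smaller than \<open>b\<close>.\<close>

lemma cos_le_minus_half:
  fixes y :: real
  assumes "2 * pi / 3 \<le> \<bar>y\<bar>" "\<bar>y\<bar> \<le> 4 * pi / 3"
  shows "cos y \<le> - 1 / 2"
proof -
  have "cos (pi / 3) \<le> cos \<bar>\<bar>y\<bar> - pi\<bar>"
  proof (rule cos_monotone_0_pi_le)
    show "\<bar>\<bar>y\<bar> - pi\<bar> \<le> pi / 3" using assms by linarith
  qed auto
  moreover have "cos (\<bar>y\<bar> - pi) = - cos y" by (cases "0 \<le> y") (simp_all add: cos_diff)
  ultimately show ?thesis by (simp add: cos_60)
qed

lemma cos_ge_minus_half:
  fixes y :: real
  assumes "\<bar>y\<bar> \<le> 2 * pi / 3"
  shows "- 1 / 2 \<le> cos y"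
proof -
  have "cos (2 * pi / 3) \<le> cos \<bar>y\<bar>"
    using assms by (intro cos_monotone_0_pi_le) auto
  then show ?thesis by (simp add: cos_120)
qed

lemma pi_ge_3: "3 \<le> pi"
proof -
  have "sin (pi / 6) \<le> pi / 6" by (rule sin_x_le_x) simp
  then show ?thesis by (simp add: sin_30)
qed

lemma (in prob_space)
  assumes [measurable]: "\<xi> \<in> borel_measurable M"
  shows expectation_cos: "expectation (\<lambda>\<omega>. cos (u * \<xi> \<omega>)) = Re (expectation (\<lambda>\<omega>. exp (\<i> * of_real (u * \<xi> \<omega>))))"
    and expectation_sin: "expectation (\<lambda>\<omega>. sin (u * \<xi> \<omega>)) = Im (expectation (\<lambda>\<omega>. exp (\<i> * of_real (u * \<xi> \<omega>))))"
proof -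
  have "integrable M (\<lambda>\<omega>. exp (\<i> * of_real (u * \<xi> \<omega>)))"
    by (intro integrable_const_bound[where B=1]) auto
  from integral_Re[OF this] integral_Im[OF this]
  show "expectation (\<lambda>\<omega>. cos (u * \<xi> \<omega>)) = Re (expectation (\<lambda>\<omega>. exp (\<i> * of_real (u * \<xi> \<omega>))))"
    and "expectation (\<lambda>\<omega>. sin (u * \<xi> \<omega>)) = Im (expectation (\<lambda>\<omega>. exp (\<i> * of_real (u * \<xi> \<omega>))))"
    by (simp_all add: Re_exp Im_exp)
qed

section \<open>Cadlag paths on the dyadic grid\<close>

text \<open>One-sided limits give a bound near every point, and bisection makes it global.\<close>

lemma cadlag_bounded:
  assumes "cadlag_on_unit f"
  obtains B where "\<And>t. t \<in> {0..1} \<Longrightarrow> \<bar>f t\<bar> \<le> B"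
proof -
  \<comment> \<open>The local condition of \<open>Bolzano\<close> ranges over all short intervals
    around a point, including those that stick out of the unit interval; hence the
    intersection.\<close>
  let ?P = "\<lambda>a b. \<exists>B. \<forall>t\<in>{a..b} \<inter> {0..1}. \<bar>f t\<bar> \<le> B"
  have "?P 0 1"
  proof (rule Bolzano[where P="?P"])
    fix a b c assume "?P a b" "?P b c"
    then obtain B C where "\<forall>t\<in>{a..b} \<inter> {0..1}. \<bar>f t\<bar> \<le> B" "\<forall>t\<in>{b..c} \<inter> {0..1}. \<bar>f t\<bar> \<le> C"
      by blast
    then have "\<forall>t\<in>{a..c} \<inter> {0..1}. \<bar>f t\<bar> \<le> max B C"
      by (metis IntE IntI atLeastAtMost_iff le_max_iff_disj linear)
    then show "?P a c" by blast
  next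
    fix x :: real assume x: "0 \<le> x" "x \<le> 1"
    have bdd: "\<exists>B. \<forall>\<^sub>F t in G. \<bar>f t\<bar> \<le> B" if lim: "(f \<longlongrightarrow> l) G" for G l
    proof -
      have "\<forall>\<^sub>F t in G. \<bar>f t\<bar> < \<bar>l\<bar> + 1"
        using order_tendstoD(2)[OF tendsto_rabs[OF lim], of "\<bar>l\<bar> + 1"] by simp
      then have "\<forall>\<^sub>F t in G. \<bar>f t\<bar> \<le> \<bar>l\<bar> + 1" by (rule eventually_mono) simp
      then show ?thesis by blast
    qed
    have "\<exists>B d. x < d \<and> (\<forall>t. x < t \<and> t < d \<and> t \<le> 1 \<longrightarrow> \<bar>f t\<bar> \<le> B)"
    proof (cases "x < 1")
      case True
      then have "(f \<longlongrightarrow> f x) (at_right x)" using assms x by (simp add: cadlag_on_unit_def)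
      from bdd[OF this] show ?thesis by (auto simp: eventually_at_right_field)
    next
      case False
      then show ?thesis by (intro exI[of _ 0] exI[of _ "x + 1"]) auto
    qed
    then obtain B d where d: "x < d" "\<And>t. x < t \<Longrightarrow> t < d \<Longrightarrow> t \<le> 1 \<Longrightarrow> \<bar>f t\<bar> \<le> B" by blast
    have "\<exists>C c. c < x \<and> (\<forall>t. c < t \<and> t < x \<and> 0 \<le> t \<longrightarrow> \<bar>f t\<bar> \<le> C)"
    proof (cases "0 < x")
      case True
      then have "x \<in> {0<..1}" using x by simp
      then obtain l where "(f \<longlongrightarrow> l) (at_left x)" using assms unfolding cadlag_on_unit_def by blast
      from bdd[OF this] show ?thesis by (auto simp: eventually_at_left_field)
    next
      case False
      then show ?thesis by (intro exI[of _ 0] exI[of _ "x - 1"]) auto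
    qed
    then obtain C c where c: "c < x" "\<And>t. c < t \<Longrightarrow> t < x \<Longrightarrow> 0 \<le> t \<Longrightarrow> \<bar>f t\<bar> \<le> C" by blast
    show "\<exists>r>0. \<forall>a b. a \<le> x \<and> x \<le> b \<and> b - a < r \<longrightarrow> ?P a b"
    proof (rule exI[of _ "min (d - x) (x - c)"], intro conjI allI impI)
      fix a b assume ab: "a \<le> x \<and> x \<le> b \<and> b - a < min (d - x) (x - c)"
      have "\<bar>f t\<bar> \<le> max \<bar>f x\<bar> (max B C)" if "t \<in> {a..b} \<inter> {0..1}" for t
        using that ab d(2)[of t] c(2)[of t] by (cases t x rule: linorder_cases) auto
      then show "?P a b" by blast
    qed (use c d in auto)
  qed auto
  then obtain B where "\<forall>t\<in>{0..1} \<inter> {0..1}. \<bar>f t\<bar> \<le> B" ..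
  then show thesis by (intro that[of B]) auto
qed

lemma dyadic_between:
  fixes s t :: real
  assumes "0 \<le> s" "s < t"
  obtains j m :: nat where "s < j / 2 ^ m" "j / 2 ^ m < t"
proof -
  obtain m :: nat where "1 / (t - s) < 2 ^ m"
    using real_arch_pow[of 2 "1 / (t - s)"] by auto
  then have m: "1 < 2 ^ m * (t - s)"
    using assms by (simp add: field_simps)
  \<comment> \<open>The successor of the floor, so that \<open>j / 2 ^ m\<close> exceeds
    \<open>s\<close> strictly even if \<open>s\<close> is itself dyadic.\<close>
  define j where "j = nat \<lfloor>2 ^ m * s\<rfloor> + 1"
  have "real j = of_int \<lfloor>2 ^ m * s\<rfloor> + 1"
    using assms by (simp add: j_def)
  then have "2 ^ m * s < j" "j \<le> 2 ^ m * s + 1" by linarith+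
  then show thesis
    using m by (intro that[of j m]) (auto simp: field_simps)
qed

text \<open>If \<open>\<bar>f\<bar>\<close> exceeded \<open>a\<close> at some \<open>t < 1\<close>,
  right-continuity would carry this to a dyadic point just after \<open>t\<close>. Conversely,
  boundedness of the path is what makes the real-valued supremum an upper bound.\<close>

lemma unit_sup_norm_le_iff:
  assumes cadlag: "cadlag_on_unit f"
  shows "unit_sup_norm f \<le> a \<longleftrightarrow> (\<forall>m. \<forall>j\<le>2 ^ m. \<bar>f (real j / 2 ^ m)\<bar> \<le> a)"
proof
  assume le: "unit_sup_norm f \<le> a"
  obtain B where "\<And>t. t \<in> {0..1} \<Longrightarrow> \<bar>f t\<bar> \<le> B"
    using cadlag_bounded[OF cadlag] by metis
  then have "bdd_above ((\<lambda>t. \<bar>f t\<bar>) ` {0..1})" by (intro bdd_aboveI2[where M=B]) simp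
  then have *: "\<bar>f t\<bar> \<le> a" if "t \<in> {0..1}" for t
    using cSUP_upper[OF that, of "\<lambda>t. \<bar>f t\<bar>"] le unfolding unit_sup_norm_def by linarith
  have "real j / 2 ^ m \<in> {0..1}" if "j \<le> 2 ^ m" for j m :: nat
    using of_nat_mono[OF that, where 'a=real] by simp
  with * show "\<forall>m. \<forall>j\<le>2 ^ m. \<bar>f (real j / 2 ^ m)\<bar> \<le> a" by blast
next
  assume dyadic: "\<forall>m. \<forall>j\<le>2 ^ m. \<bar>f (real j / 2 ^ m)\<bar> \<le> a"
  have "\<bar>f t\<bar> \<le> a" if t: "t \<in> {0..1}" for t
  proof (cases "t = 1")
    case True
    \<comment> \<open>The end point is the grid point with \<open>j = 1\<close> and
      \<open>m = 0\<close>; nothing lies to its right to approximate it from.\<close>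
    then show ?thesis using dyadic[rule_format, of 1 0] by simp
  next
    case False
    then have t': "0 \<le> t" "t < 1" using t by auto
    show ?thesis
    proof (rule ccontr)
      assume "\<not> \<bar>f t\<bar> \<le> a"
      moreover have "(f \<longlongrightarrow> f t) (at_right t)"
        using cadlag t' by (simp add: cadlag_on_unit_def)
      ultimately have "\<forall>\<^sub>F s in at_right t. a < \<bar>f s\<bar>"
        by (intro order_tendstoD(1)[OF tendsto_rabs]) auto
      then obtain d where d: "t < d" "\<And>s. t < s \<Longrightarrow> s < d \<Longrightarrow> a < \<bar>f s\<bar>"
        by (auto simp: eventually_at_right_field)
      \<comment> \<open>The minimum with 1 keeps the dyadic point inside the unit interval.\<close>
      obtain j m :: nat where jm: "t < j / 2 ^ m" "j / 2 ^ m < min d 1"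
        using dyadic_between[of t "min d 1"] t' d by auto
      then have "real j < real (2 ^ m)" by (simp add: field_simps)
      then have "j \<le> 2 ^ m" unfolding of_nat_less_iff by simp
      then have "\<bar>f (j / 2 ^ m)\<bar> \<le> a" using dyadic by blast
      moreover have "a < \<bar>f (j / 2 ^ m)\<bar>" using jm by (intro d(2)) auto
      ultimately show False by simp
    qed
  qed
  then show "unit_sup_norm f \<le> a"
    unfolding unit_sup_norm_def by (intro cSUP_least) auto
qed

section \<open>The exponent of a martingale with small jumps\<close>

text \<open>The analytic data alone, so that the exponent can be studied without the
  process.\<close>

locale small_jumps =
  fixes \<nu> :: "real measure" and \<sigma>2 \<epsilon> :: real
  assumes eps_pos: "0 < \<epsilon>"
    and sigma2_ge_0: "0 \<le> \<sigma>2"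
    and sets_nu_borel [measurable_cong]: "sets \<nu> = sets borel"
    and min_finite: "(\<integral>\<^sup>+ x. ennreal (min \<bar>x\<bar> (x\<^sup>2)) \<partial>\<nu>) < \<infinity>"
    and concentrated: "emeasure \<nu> (- {-\<epsilon>..\<epsilon>}) = 0"
begin

definition jumps :: "real set" where
  "jumps = {-\<epsilon>..\<epsilon>} - {0}"

text \<open>The variance of the martingale per unit time, equal to
  \<open>\<epsilon>\<^sup>2 * F\<close>.\<close>

definition variance_rate :: real where
  "variance_rate = \<sigma>2 + (LINT x:jumps|\<nu>. x\<^sup>2)"

lemma sets_jumps [measurable]: "jumps \<in> sets \<nu>"
  by (simp add: jumps_def sets_nu_borel)

text \<open>For \<open>\<bar>x\<bar> \<le> \<epsilon>\<close> the square is at most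
  \<open>max 1 \<epsilon>\<close> times the integrable function
  \<open>min \<bar>x\<bar> (x\<^sup>2)\<close>.\<close>

lemma integrable_square_jumps: "set_integrable \<nu> jumps (\<lambda>x. x\<^sup>2)"
proof -
  have "(\<integral>\<^sup>+ x. ennreal (norm (indicator jumps x *\<^sub>R x\<^sup>2)) \<partial>\<nu>)
      \<le> (\<integral>\<^sup>+ x. ennreal (max 1 \<epsilon>) * ennreal (min \<bar>x\<bar> (x\<^sup>2)) \<partial>\<nu>)"
  proof (intro nn_integral_mono)
    fix x :: real
    have "x\<^sup>2 \<le> max 1 \<epsilon> * min \<bar>x\<bar> (x\<^sup>2)" if "\<bar>x\<bar> \<le> \<epsilon>"
    proof (cases "\<bar>x\<bar> \<le> x\<^sup>2")
      case True
      have "x\<^sup>2 = \<bar>x\<bar> * \<bar>x\<bar>" by (simp add: power2_eq_square)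
      also have "\<dots> \<le> max 1 \<epsilon> * \<bar>x\<bar>" using that by (intro mult_right_mono) auto
      finally show ?thesis using True by simp
    next
      case False
      have "1 * x\<^sup>2 \<le> max 1 \<epsilon> * x\<^sup>2" by (intro mult_right_mono) auto
      then show ?thesis using False by simp
    qed
    then show "ennreal (norm (indicator jumps x *\<^sub>R x\<^sup>2))
        \<le> ennreal (max 1 \<epsilon>) * ennreal (min \<bar>x\<bar> (x\<^sup>2))"
      by (auto simp: jumps_def indicator_def abs_le_iff simp flip: ennreal_mult intro!: ennreal_leI)
  qed
  also have "\<dots> = ennreal (max 1 \<epsilon>) * (\<integral>\<^sup>+ x. ennreal (min \<bar>x\<bar> (x\<^sup>2)) \<partial>\<nu>)"
    by (rule nn_integral_cmult) measurable
  also have "\<dots> < \<infinity>"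
    using min_finite by (simp add: ennreal_mult_less_top)
  finally show ?thesis
    unfolding set_integrable_def by (intro integrableI_bounded) simp_all
qed

lemma set_integrable_if_square_bound:
  fixes f :: "real \<Rightarrow> 'b :: {banach, second_countable_topology}"
  assumes [measurable]: "f \<in> borel_measurable borel"
    and bound: "\<And>x. x \<in> jumps \<Longrightarrow> norm (f x) \<le> c * x\<^sup>2"
  shows "set_integrable \<nu> jumps f"
  unfolding set_integrable_def
proof (rule Bochner_Integration.integrable_bound)
  show "integrable \<nu> (\<lambda>x. c * (indicator jumps x *\<^sub>R x\<^sup>2))"
    using integrable_square_jumps unfolding set_integrable_def by simp
  show "AE x in \<nu>. norm (indicator jumps x *\<^sub>R f x) \<le> norm (c * (indicator jumps x *\<^sub>R x\<^sup>2))"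
    using bound by (intro AE_I2) (force simp: indicator_def)
qed simp

lemma square_jumps_nonneg: "0 \<le> (LINT x:jumps|\<nu>. x\<^sup>2)"
  unfolding set_lebesgue_integral_def by (intro integral_nonneg_AE) auto

lemma variance_rate_nonneg: "0 \<le> variance_rate"
  unfolding variance_rate_def using square_jumps_nonneg sigma2_ge_0 by simp

lemma set_integral_square_bound:
  fixes f :: "real \<Rightarrow> real"
  assumes "f \<in> borel_measurable borel"
    and bound: "\<And>x. x \<in> jumps \<Longrightarrow> \<bar>f x\<bar> \<le> c * x\<^sup>2"
  shows "\<bar>LINT x:jumps|\<nu>. f x\<bar> \<le> c * (LINT x:jumps|\<nu>. x\<^sup>2)"
proof -
  have 1: "set_integrable \<nu> jumps f"
    using assms by (intro set_integrable_if_square_bound[where c=c]) auto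
  have "\<bar>LINT x:jumps|\<nu>. f x\<bar> \<le> (LINT x:jumps|\<nu>. \<bar>f x\<bar>)"
    using set_integral_norm_bound[OF 1] by simp
  also have "\<dots> \<le> (LINT x:jumps|\<nu>. c * x\<^sup>2)"
    using 1 bound integrable_square_jumps
    by (intro set_integral_mono) (auto intro: set_integrable_abs)
  finally show ?thesis by simp
qed

abbreviation (input) jump_integrand :: "real \<Rightarrow> real \<Rightarrow> complex" where
  "jump_integrand u x \<equiv> 1 - exp (\<i> * of_real (u * x)) + \<i> * of_real (u * x)"

lemma set_integrable_jump_integrand: "set_integrable \<nu> jumps (jump_integrand u)"
proof (rule set_integrable_if_square_bound)
  show "norm (jump_integrand u x) \<le> u\<^sup>2 / 2 * x\<^sup>2" for x
    using norm_one_minus_iexp_le[of "u * x"] by (simp add: power_mult_distrib)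
qed simp

lemma levy_exponent_jumps:
  "levy_exponent \<nu> \<sigma>2 u = of_real (\<sigma>2 / 2 * u\<^sup>2) + (LINT x:jumps|\<nu>. jump_integrand u x)"
proof -
  have "AE x in \<nu>. x \<in> {-\<epsilon>..\<epsilon>}"
    using concentrated by (intro AE_I[where N="- {-\<epsilon>..\<epsilon>}"]) (auto simp: sets_nu_borel)
  then have "(LINT x:(- {0})|\<nu>. jump_integrand u x) = (LINT x:jumps|\<nu>. jump_integrand u x)"
    unfolding set_lebesgue_integral_def
    by (intro integral_cong_AE) (simp_all, force simp: jumps_def indicator_def elim: eventually_mono)
  then show ?thesis by (simp add: levy_exponent_def)
qed

lemma Re_levy_exponent:
  "Re (levy_exponent \<nu> \<sigma>2 u) = \<sigma>2 / 2 * u\<^sup>2 + (LINT x:jumps|\<nu>. 1 - cos (u * x))"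
  using integral_Re[OF set_integrable_jump_integrand[of u, unfolded set_integrable_def]]
  by (simp add: levy_exponent_jumps set_lebesgue_integral_def Re_exp)

lemma Im_levy_exponent:
  "Im (levy_exponent \<nu> \<sigma>2 u) = (LINT x:jumps|\<nu>. u * x - sin (u * x))"
  using integral_Im[OF set_integrable_jump_integrand[of u, unfolded set_integrable_def]]
  by (simp add: levy_exponent_jumps set_lebesgue_integral_def Im_exp)

lemma norm_levy_exponent_le: "norm (levy_exponent \<nu> \<sigma>2 u) \<le> u\<^sup>2 / 2 * variance_rate"
proof -
  have "norm (LINT x:jumps|\<nu>. jump_integrand u x) \<le> (LINT x:jumps|\<nu>. norm (jump_integrand u x))"
    by (rule set_integral_norm_bound[OF set_integrable_jump_integrand])
  also have "\<dots> \<le> (LINT x:jumps|\<nu>. u\<^sup>2 / 2 * x\<^sup>2)"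
  proof (rule set_integral_mono)
    show "set_integrable \<nu> jumps (\<lambda>x. norm (jump_integrand u x))"
      by (rule set_integrable_norm[OF set_integrable_jump_integrand])
    show "norm (jump_integrand u x) \<le> u\<^sup>2 / 2 * x\<^sup>2" for x
      using norm_one_minus_iexp_le[of "u * x"] by (simp add: power_mult_distrib)
  qed (use integrable_square_jumps in simp)
  finally have "norm (LINT x:jumps|\<nu>. jump_integrand u x) \<le> (LINT x:jumps|\<nu>. u\<^sup>2 / 2 * x\<^sup>2)" .
  moreover have "norm (of_real (\<sigma>2 / 2 * u\<^sup>2) :: complex) = \<sigma>2 / 2 * u\<^sup>2"
    unfolding norm_of_real using sigma2_ge_0 by simp
  ultimately have "norm (levy_exponent \<nu> \<sigma>2 u) \<le> \<sigma>2 / 2 * u\<^sup>2 + u\<^sup>2 / 2 * (LINT x:jumps|\<nu>. x\<^sup>2)"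
    unfolding levy_exponent_jumps by (intro order_trans[OF norm_triangle_ineq]) simp
  then show ?thesis by (simp add: variance_rate_def algebra_simps)
qed

lemma Re_levy_exponent_le: "Re (levy_exponent \<nu> \<sigma>2 u) \<le> u\<^sup>2 / 2 * variance_rate"
  using order_trans[OF complex_Re_le_cmod norm_levy_exponent_le] .

text \<open>Bounded jumps give \<open>x ^ 4 \<le> \<epsilon>\<^sup>2 * x\<^sup>2\<close>, which
  turns the quartic Taylor correction into a multiple of the variance. For the Gaussian part that
  correction only weakens the bound.\<close>

lemma Re_levy_exponent_ge:
  "(u\<^sup>2 / 2 - u ^ 4 * \<epsilon>\<^sup>2 / 24) * variance_rate \<le> Re (levy_exponent \<nu> \<sigma>2 u)"
proof -
  have "(LINT x:jumps|\<nu>. (u\<^sup>2 / 2 - u ^ 4 * \<epsilon>\<^sup>2 / 24) * x\<^sup>2) \<le> (LINT x:jumps|\<nu>. 1 - cos (u * x))"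
  proof (rule set_integral_mono)
    show "set_integrable \<nu> jumps (\<lambda>x. (u\<^sup>2 / 2 - u ^ 4 * \<epsilon>\<^sup>2 / 24) * x\<^sup>2)"
      using integrable_square_jumps by simp
    show "set_integrable \<nu> jumps (\<lambda>x. 1 - cos (u * x))"
      using one_minus_cos_le[of "u * x" for x]
      by (intro set_integrable_if_square_bound[where c="u\<^sup>2 / 2"]) (auto simp: power_mult_distrib)
    fix x assume "x \<in> jumps"
    then have "x\<^sup>2 \<le> \<epsilon>\<^sup>2" by (intro abs_le_square_iff[THEN iffD1]) (auto simp: jumps_def)
    then have "u ^ 4 * (x\<^sup>2 * x\<^sup>2) \<le> u ^ 4 * (\<epsilon>\<^sup>2 * x\<^sup>2)"
      by (intro mult_left_mono mult_right_mono) auto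
    then show "(u\<^sup>2 / 2 - u ^ 4 * \<epsilon>\<^sup>2 / 24) * x\<^sup>2 \<le> 1 - cos (u * x)"
      using one_minus_cos_ge[of "u * x"]
      by (simp add: algebra_simps power_mult_distrib flip: power_add)
  qed
  moreover have "(u\<^sup>2 / 2 - u ^ 4 * \<epsilon>\<^sup>2 / 24) * \<sigma>2 \<le> \<sigma>2 / 2 * u\<^sup>2"
    using mult_nonneg_nonneg[of "u ^ 4 * \<epsilon>\<^sup>2" \<sigma>2] sigma2_ge_0 by (simp add: algebra_simps)
  ultimately show ?thesis
    unfolding Re_levy_exponent variance_rate_def distrib_left set_integral_mult_right by linarith
qed

text \<open>The Gaussian part is real, and the cubic remainder of the sine is at most a multiple of
  \<open>\<epsilon> * x\<^sup>2\<close> on the jumps.\<close>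

lemma abs_Im_levy_exponent_le:
  assumes "0 \<le> u"
  shows "\<bar>Im (levy_exponent \<nu> \<sigma>2 u)\<bar> \<le> u ^ 3 * \<epsilon> / 6 * variance_rate"
proof -
  have "\<bar>LINT x:jumps|\<nu>. u * x - sin (u * x)\<bar> \<le> u ^ 3 * \<epsilon> / 6 * (LINT x:jumps|\<nu>. x\<^sup>2)"
  proof (rule set_integral_square_bound)
    fix x assume "x \<in> jumps"
    then have "u ^ 3 * (x\<^sup>2 * \<bar>x\<bar>) \<le> u ^ 3 * (x\<^sup>2 * \<epsilon>)"
      using assms by (intro mult_left_mono) (auto simp: jumps_def)
    moreover have "\<bar>x\<bar> ^ 3 = x\<^sup>2 * \<bar>x\<bar>"
      by (simp add: power3_eq_cube power2_eq_square)
    ultimately show "\<bar>u * x - sin (u * x)\<bar> \<le> u ^ 3 * \<epsilon> / 6 * x\<^sup>2"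
      using abs_diff_sin_le[of "u * x"] assms by (simp add: abs_mult power_mult_distrib mult_ac)
  qed simp
  also have "\<dots> \<le> u ^ 3 * \<epsilon> / 6 * variance_rate"
    using sigma2_ge_0 assms eps_pos by (intro mult_left_mono) (auto simp: variance_rate_def)
  finally show ?thesis by (simp add: Im_levy_exponent)
qed

text \<open>A fourth difference annihilates quadratic functions, so the Gaussian part cancels; a
  jump \<open>x\<close> contributes at most \<open>(u * x) ^ 4\<close>, and two of these four
  factors \<open>x\<close> are bounded by \<epsilon>.\<close>

lemma fourth_difference_levy_exponent_le:
  "8 * Re (levy_exponent \<nu> \<sigma>2 u) - 2 * Re (levy_exponent \<nu> \<sigma>2 (2 * u)) \<le> u ^ 4 * \<epsilon>\<^sup>2 * variance_rate"
proof -
  have int: "set_integrable \<nu> jumps (\<lambda>x. 1 - cos (v * x))" for v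
    using one_minus_cos_le[of "v * x" for x]
    by (intro set_integrable_if_square_bound[where c="v\<^sup>2 / 2"]) (auto simp: power_mult_distrib)
  have "8 * Re (levy_exponent \<nu> \<sigma>2 u) - 2 * Re (levy_exponent \<nu> \<sigma>2 (2 * u))
      = 8 * (LINT x:jumps|\<nu>. 1 - cos (u * x)) - 2 * (LINT x:jumps|\<nu>. 1 - cos (2 * u * x))"
    by (simp add: Re_levy_exponent power_mult_distrib)
  also have "\<dots> = (LINT x:jumps|\<nu>. 8 * (1 - cos (u * x)) - 2 * (1 - cos (2 * u * x)))"
    using int by (subst set_integral_diff) (simp_all only: set_integral_mult_right set_integrable_mult_right)
  also have "\<dots> = (LINT x:jumps|\<nu>. 4 * (1 - cos (u * x))\<^sup>2)"
    by (intro arg_cong[where f="set_lebesgue_integral \<nu> jumps"] ext)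
      (simp add: mult.assoc flip: cos_fourth_difference)
  also have "\<dots> \<le> u ^ 4 * \<epsilon>\<^sup>2 * (LINT x:jumps|\<nu>. x\<^sup>2)"
  proof (rule order_trans[OF abs_ge_self set_integral_square_bound])
    fix x assume "x \<in> jumps"
    then have x: "x\<^sup>2 \<le> \<epsilon>\<^sup>2" by (intro abs_le_square_iff[THEN iffD1]) (auto simp: jumps_def)
    have "(1 - cos (u * x))\<^sup>2 \<le> ((u * x)\<^sup>2 / 2)\<^sup>2"
      using one_minus_cos_le[of "u * x"] by (intro power_mono) auto
    then have "4 * (1 - cos (u * x))\<^sup>2 \<le> u ^ 4 * (x\<^sup>2 * x\<^sup>2)"
      by (simp add: power_mult_distrib power_divide flip: power_mult power_add)
    also have "\<dots> \<le> u ^ 4 * (\<epsilon>\<^sup>2 * x\<^sup>2)"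
      using x by (intro mult_left_mono mult_right_mono) auto
    finally show "\<bar>4 * (1 - cos (u * x))\<^sup>2\<bar> \<le> u ^ 4 * \<epsilon>\<^sup>2 * x\<^sup>2" by simp
  qed simp
  also have "\<dots> \<le> u ^ 4 * \<epsilon>\<^sup>2 * variance_rate"
    using sigma2_ge_0 by (intro mult_left_mono) (auto simp: variance_rate_def)
  finally show ?thesis .
qed

text \<open>The second assumption keeps the argument of \<open>exp\<close> in the unit disc; 3/4 is
  3 times the square of the 1/2 in the bound on the exponent.\<close>

lemma norm_char_minus_linear_le:
  assumes "0 \<le> t" "t * (u\<^sup>2 * variance_rate) \<le> 2"
  shows "norm (exp (- of_real t * levy_exponent \<nu> \<sigma>2 u) - (1 - of_real t * levy_exponent \<nu> \<sigma>2 u))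
    \<le> 3 / 4 * t\<^sup>2 * u ^ 4 * variance_rate\<^sup>2"
proof -
  let ?z = "- of_real t * levy_exponent \<nu> \<sigma>2 u"
  have z: "norm ?z \<le> t * (u\<^sup>2 / 2 * variance_rate)"
    unfolding norm_mult using mult_left_mono[OF norm_levy_exponent_le[of u] assms(1)] assms(1) by simp
  then have "norm ?z \<le> 1" using assms by simp
  then have "norm (exp ?z - 1 - ?z) \<le> 3 * (norm ?z)\<^sup>2"
    by (rule norm_exp_minus_linear_le)
  also have "\<dots> \<le> 3 * (t * (u\<^sup>2 / 2 * variance_rate))\<^sup>2"
    using z by (intro mult_left_mono power_mono) auto
  finally show ?thesis
    by (simp add: power_mult_distrib power_divide algebra_simps flip: power_mult)
qed

end

section \<open>The tail of a single step\<close>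

text \<open>Markov's inequality for the fourth moment. For \<open>b = 3 * \<epsilon>\<close> the
  leading term is \<open>t * F / 81\<close>; the second moment would give order
  \<open>t * F / 9\<close>, more than the drift in \<open>char_expands\<close> can absorb.\<close>

lemma (in small_jumps) prob_big_step_le:
  assumes "prob_space M" and [measurable]: "\<xi> \<in> borel_measurable M"
    and char: "\<And>u. (\<integral>\<omega>. exp (\<i> * of_real (u * \<xi> \<omega>)) \<partial>M) = exp (- of_real t * levy_exponent \<nu> \<sigma>2 u)"
    and t: "0 \<le> t" and b: "0 < b"
  shows "measure M {\<omega> \<in> space M. b \<le> \<bar>\<xi> \<omega>\<bar>}
    \<le> (t * \<epsilon>\<^sup>2 * variance_rate + 30 * t\<^sup>2 * variance_rate\<^sup>2) / b ^ 4"
proof -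
  interpret prob_space M by fact
  let ?V = variance_rate and ?\<psi> = "levy_exponent \<nu> \<sigma>2"
  let ?C = "t * \<epsilon>\<^sup>2 * ?V + 30 * t\<^sup>2 * ?V\<^sup>2"
  have C: "0 \<le> ?C" using t variance_rate_nonneg by simp
  have fourth: "expectation (\<lambda>\<omega>. 4 * (1 - cos (u * \<xi> \<omega>))\<^sup>2) \<le> u ^ 4 * ?C"
    if u: "t * ((2 * u)\<^sup>2 * ?V) \<le> 2" for u
  proof -
    let ?r = "3 / 4 * t\<^sup>2 * u ^ 4 * ?V\<^sup>2"
    have int: "integrable M (\<lambda>\<omega>. cos (v * \<xi> \<omega>))" for v
      by (intro integrable_const_bound[where B=1]) auto
    have "t * (u\<^sup>2 * ?V) \<le> 2"
      using t variance_rate_nonneg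
      by (intro order_trans[OF _ u] mult_left_mono mult_right_mono) (auto simp: power_mult_distrib)
    then have "norm (exp (- of_real t * ?\<psi> u) - (1 - of_real t * ?\<psi> u)) \<le> ?r"
      by (rule norm_char_minus_linear_le[OF t])
    from order_trans[OF abs_Re_le_cmod this]
    have "\<bar>Re (exp (- of_real t * ?\<psi> u)) - (1 - t * Re (?\<psi> u))\<bar> \<le> ?r" by simp
    then have 1: "1 - t * Re (?\<psi> u) - ?r \<le> Re (exp (- of_real t * ?\<psi> u))"
      unfolding abs_le_iff by linarith
    have "norm (exp (- of_real t * ?\<psi> (2 * u)) - (1 - of_real t * ?\<psi> (2 * u))) \<le> 3 / 4 * t\<^sup>2 * (2 * u) ^ 4 * ?V\<^sup>2"
      by (rule norm_char_minus_linear_le[OF t u])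
    from order_trans[OF abs_Re_le_cmod this]
    have "\<bar>Re (exp (- of_real t * ?\<psi> (2 * u))) - (1 - t * Re (?\<psi> (2 * u)))\<bar> \<le> 16 * ?r"
      by (simp add: power_mult_distrib)
    then have 2: "Re (exp (- of_real t * ?\<psi> (2 * u))) \<le> 1 - t * Re (?\<psi> (2 * u)) + 16 * ?r"
      unfolding abs_le_iff by linarith
    have "expectation (\<lambda>\<omega>. 4 * (1 - cos (u * \<xi> \<omega>))\<^sup>2)
        = expectation (\<lambda>\<omega>. 6 - 8 * cos (u * \<xi> \<omega>) + 2 * cos (2 * u * \<xi> \<omega>))"
      by (simp only: cos_fourth_difference[symmetric] mult.assoc)
    also have "\<dots> = 6 - 8 * expectation (\<lambda>\<omega>. cos (u * \<xi> \<omega>)) + 2 * expectation (\<lambda>\<omega>. cos (2 * u * \<xi> \<omega>))"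
      using int by (simp add: prob_space)
    also have "\<dots> = 6 - 8 * Re (exp (- of_real t * ?\<psi> u)) + 2 * Re (exp (- of_real t * ?\<psi> (2 * u)))"
      by (simp only: expectation_cos[OF assms(2)] char)
    also have "\<dots> \<le> 6 - 8 * (1 - t * Re (?\<psi> u) - ?r) + 2 * (1 - t * Re (?\<psi> (2 * u)) + 16 * ?r)"
      by (intro add_mono diff_mono mult_left_mono order_refl 1 2) simp_all
    \<comment> \<open>The constants cancel because 6 - 8 + 2 = 0. The linearisation errors add up to
      8 + 2 * 16 = 40 times \<open>?r\<close>, and 40 * 3/4 is the 30 in \<open>?C\<close>.\<close>
    also have "\<dots> = t * (8 * Re (?\<psi> u) - 2 * Re (?\<psi> (2 * u))) + 40 * ?r"
    proof -
      have "6 - 8 * (1 - t * x - r) + 2 * (1 - t * y + 16 * r) = t * (8 * x - 2 * y) + 40 * r" for x y r :: real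
        by (simp add: algebra_simps)
      then show ?thesis .
    qed
    also have "\<dots> \<le> t * (u ^ 4 * \<epsilon>\<^sup>2 * ?V) + 40 * ?r"
      using fourth_difference_levy_exponent_le[of u] t by (intro add_right_mono mult_left_mono)
    also have "\<dots> = u ^ 4 * ?C" by (simp add: algebra_simps)
    finally show ?thesis .
  qed
  let ?g = "\<lambda>m \<omega>. 4 * (1 - cos (\<xi> \<omega> / real (Suc m)))\<^sup>2 * real (Suc m) ^ 4"
  \<comment> \<open>The frequency \<open>1 / Suc m\<close> tends to zero, so \<open>fourth\<close>
    eventually applies, uniformly in the bound \<open>?C\<close>.\<close>
  have "(\<lambda>m. t * ((2 * inverse (real (Suc m)))\<^sup>2 * ?V)) \<longlonglongrightarrow> t * ((2 * 0)\<^sup>2 * ?V)"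
    by (intro tendsto_intros LIMSEQ_inverse_real_of_nat)
  then have "\<forall>\<^sub>F m in sequentially. t * ((2 * inverse (real (Suc m)))\<^sup>2 * ?V) < 2"
    by (rule order_tendstoD) simp
  then have ev: "\<forall>\<^sub>F m in sequentially. (\<integral>\<^sup>+ \<omega>. ennreal (?g m \<omega>) \<partial>M) \<le> ennreal ?C"
  proof (rule eventually_mono)
    fix m assume m: "t * ((2 * inverse (real (Suc m)))\<^sup>2 * ?V) < 2"
    let ?u = "inverse (real (Suc m))"
    have sq: "\<bar>(1 - cos x)\<^sup>2\<bar> \<le> 4" for x :: real
      using power_mono[of "1 - cos x" 2 2] cos_ge_minus_one[of x] cos_le_one[of x] by simp
    have int: "integrable M (\<lambda>\<omega>. 4 * (1 - cos (?u * \<xi> \<omega>))\<^sup>2)"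
      using sq by (intro integrable_mult_right integrable_const_bound[where B=4]) auto
    have g: "?g m \<omega> = real (Suc m) ^ 4 * (4 * (1 - cos (?u * \<xi> \<omega>))\<^sup>2)" for \<omega>
      by (simp add: divide_inverse mult_ac)
    have "(\<integral>\<^sup>+ \<omega>. ennreal (?g m \<omega>) \<partial>M) = ennreal (expectation (\<lambda>\<omega>. real (Suc m) ^ 4 * (4 * (1 - cos (?u * \<xi> \<omega>))\<^sup>2)))"
      unfolding g using int by (intro nn_integral_eq_integral integrable_mult_right) auto
    also have "expectation (\<lambda>\<omega>. real (Suc m) ^ 4 * (4 * (1 - cos (?u * \<xi> \<omega>))\<^sup>2))
        = real (Suc m) ^ 4 * expectation (\<lambda>\<omega>. 4 * (1 - cos (?u * \<xi> \<omega>))\<^sup>2)"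
      by (rule integral_mult_right_zero)
    also have "\<dots> \<le> real (Suc m) ^ 4 * (?u ^ 4 * ?C)"
      using m by (intro mult_left_mono fourth) auto
    also have "\<dots> = ?C"
      by (simp del: of_nat_Suc flip: mult.assoc power_mult_distrib)
    finally show "(\<integral>\<^sup>+ \<omega>. ennreal (?g m \<omega>) \<partial>M) \<le> ennreal ?C"
      by (simp add: ennreal_leI)
  qed
  \<comment> \<open>Fatou's lemma transfers the uniform bound to the fourth moment, which also
    proves that this moment is finite.\<close>
  have "(\<integral>\<^sup>+ \<omega>. ennreal (\<xi> \<omega> ^ 4) \<partial>M) = (\<integral>\<^sup>+ \<omega>. liminf (\<lambda>m. ennreal (?g m \<omega>)) \<partial>M)"
    by (intro nn_integral_cong lim_imp_Liminf[symmetric] tendsto_ennrealI scaled_cos_tendsto) simp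
  also have "\<dots> \<le> liminf (\<lambda>m. \<integral>\<^sup>+ \<omega>. ennreal (?g m \<omega>) \<partial>M)"
    by (intro nn_integral_liminf) measurable
  also have "\<dots> \<le> limsup (\<lambda>m. \<integral>\<^sup>+ \<omega>. ennreal (?g m \<omega>) \<partial>M)"
    by (intro Liminf_le_Limsup) simp
  also have "\<dots> \<le> ennreal ?C"
    using ev by (rule Limsup_bounded)
  finally have le: "(\<integral>\<^sup>+ \<omega>. ennreal (\<xi> \<omega> ^ 4) \<partial>M) \<le> ennreal ?C" .
  have int: "integrable M (\<lambda>\<omega>. \<xi> \<omega> ^ 4)"
    using le_less_trans[OF le ennreal_less_top] by (intro integrableI_bounded) auto
  then have "expectation (\<lambda>\<omega>. \<xi> \<omega> ^ 4) \<le> ?C"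
    using le C by (subst (asm) nn_integral_eq_integral) auto
  then have "expectation (\<lambda>\<omega>. \<xi> \<omega> ^ 4) / b ^ 4 \<le> ?C / b ^ 4"
    by (intro divide_right_mono) auto
  moreover have "prob {\<omega> \<in> space M. b ^ 4 \<le> \<xi> \<omega> ^ 4} \<le> expectation (\<lambda>\<omega>. \<xi> \<omega> ^ 4) / b ^ 4"
    using b int by (intro integral_Markov_inequality_measure[where A="space M"]) auto
  moreover have "{\<omega> \<in> space M. b \<le> \<bar>\<xi> \<omega>\<bar>} = {\<omega> \<in> space M. b ^ 4 \<le> \<xi> \<omega> ^ 4}"
    using b power_mono_iff[of b "\<bar>\<xi> \<omega>\<bar>" 4 for \<omega>] by (auto simp: power_even_abs)
  ultimately show ?thesis by simp
qed

section \<open>The drift of the test functions over one step\<close>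

context small_jumps
begin

text \<open>\<open>cos \<theta> * Re z - sin \<theta> * Im z\<close> is the real part of
  \<open>cis \<theta> * z\<close>, that is, the mean of \<open>cos (\<theta> + u * \<xi>)\<close> if
  \<open>z\<close> is the characteristic function of \<xi> at \<open>u\<close>. A rotation leaves
  the linearisation error unchanged in size.\<close>

lemma abs_rotated_char_minus_linear_le:
  assumes "0 \<le> t" "t * (u\<^sup>2 * variance_rate) \<le> 2"
  defines "z \<equiv> exp (- of_real t * levy_exponent \<nu> \<sigma>2 u)" and "\<psi> \<equiv> levy_exponent \<nu> \<sigma>2 u"
  shows "\<bar>(cos \<theta> * Re z - sin \<theta> * Im z) - (cos \<theta> - t * (cos \<theta> * Re \<psi> - sin \<theta> * Im \<psi>))\<bar>
    \<le> 3 / 4 * t\<^sup>2 * u ^ 4 * variance_rate\<^sup>2"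
proof -
  have "(cos \<theta> * Re z - sin \<theta> * Im z) - (cos \<theta> - t * (cos \<theta> * Re \<psi> - sin \<theta> * Im \<psi>))
      = Re (cis \<theta> * (z - (1 - of_real t * \<psi>)))"
    by (simp add: algebra_simps)
  also have "\<bar>\<dots>\<bar> \<le> norm (cis \<theta> * (z - (1 - of_real t * \<psi>)))" by (rule abs_Re_le_cmod)
  also have "\<dots> = norm (z - (1 - of_real t * \<psi>))" by (simp add: norm_mult)
  also have "\<dots> \<le> 3 / 4 * t\<^sup>2 * u ^ 4 * variance_rate\<^sup>2"
    unfolding z_def \<psi>_def using assms(1,2) by (rule norm_char_minus_linear_le)
  finally show ?thesis .
qed

abbreviation F :: real where
  "F \<equiv> levy_F \<nu> \<sigma>2 \<epsilon>"

lemma levy_F_eq: "F = variance_rate / \<epsilon>\<^sup>2"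
  by (simp add: levy_F_def variance_rate_def jumps_def)

lemma levy_F_nonneg: "0 \<le> F"
  using variance_rate_nonneg by (simp add: levy_F_eq)

lemma variance_rate_eq: "variance_rate = \<epsilon>\<^sup>2 * F"
  using eps_pos by (simp add: levy_F_eq)

text \<open>With frequencies measured in units of \<open>1 / \<epsilon>\<close>, all powers of
  \<epsilon> cancel and only \<open>F\<close> remains.\<close>

lemma scaled_levy_exponent_bounds:
  fixes w :: real
  assumes "0 \<le> w"
  defines "\<psi> \<equiv> levy_exponent \<nu> \<sigma>2 (w / \<epsilon>)"
  shows "(w\<^sup>2 / 2 - w ^ 4 / 24) * F \<le> Re \<psi>" "Re \<psi> \<le> w\<^sup>2 / 2 * F" "\<bar>Im \<psi>\<bar> \<le> w ^ 3 / 6 * F"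
proof -
  have eqs: "((w / \<epsilon>)\<^sup>2 / 2 - (w / \<epsilon>) ^ 4 * \<epsilon>\<^sup>2 / 24) * (\<epsilon>\<^sup>2 * F) = (w\<^sup>2 / 2 - w ^ 4 / 24) * F"
    "(w / \<epsilon>)\<^sup>2 / 2 * (\<epsilon>\<^sup>2 * F) = w\<^sup>2 / 2 * F" "(w / \<epsilon>) ^ 3 * \<epsilon> / 6 * (\<epsilon>\<^sup>2 * F) = w ^ 3 / 6 * F"
    using eps_pos by (simp_all add: field_simps eval_nat_numeral)
  have "0 \<le> w / \<epsilon>" using assms(1) eps_pos by simp
  from Re_levy_exponent_ge[of "w / \<epsilon>"] Re_levy_exponent_le[of "w / \<epsilon>"] abs_Im_levy_exponent_le[OF this]
  show "(w\<^sup>2 / 2 - w ^ 4 / 24) * F \<le> Re \<psi>" "Re \<psi> \<le> w\<^sup>2 / 2 * F" "\<bar>Im \<psi>\<bar> \<le> w ^ 3 / 6 * F"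
    unfolding variance_rate_eq eqs \<psi>_def .
qed

lemma scaled_char_approx:
  fixes w :: real
  assumes "0 \<le> t" "0 \<le> w" "w \<le> 1" "t * F \<le> 2"
  defines "z \<equiv> exp (- of_real t * levy_exponent \<nu> \<sigma>2 (w / \<epsilon>))" and "\<psi> \<equiv> levy_exponent \<nu> \<sigma>2 (w / \<epsilon>)"
  shows "\<bar>(cos \<theta> * Re z - sin \<theta> * Im z) - (cos \<theta> - t * (cos \<theta> * Re \<psi> - sin \<theta> * Im \<psi>))\<bar>
    \<le> 3 / 4 * (t * F)\<^sup>2"
proof -
  have eq: "(w / \<epsilon>)\<^sup>2 * variance_rate = w\<^sup>2 * F"
    "(w / \<epsilon>) ^ 4 * variance_rate\<^sup>2 = w ^ 4 * F\<^sup>2"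
    using eps_pos by (simp_all add: variance_rate_eq field_simps eval_nat_numeral)
  have "t * (w\<^sup>2 * F) \<le> t * (1 * F)"
    using assms levy_F_nonneg by (intro mult_left_mono mult_right_mono power_le_one) auto
  then have "t * ((w / \<epsilon>)\<^sup>2 * variance_rate) \<le> 2" unfolding eq using assms by simp
  from abs_rotated_char_minus_linear_le[OF assms(1) this, of \<theta>]
  have "\<bar>(cos \<theta> * Re z - sin \<theta> * Im z) - (cos \<theta> - t * (cos \<theta> * Re \<psi> - sin \<theta> * Im \<psi>))\<bar>
      \<le> 3 / 4 * t\<^sup>2 * (w ^ 4 * F\<^sup>2)"
    unfolding z_def \<psi>_def using eq(2) by (simp add: mult.assoc)
  also have "\<dots> \<le> 3 / 4 * t\<^sup>2 * (1 * F\<^sup>2)"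
    using assms by (intro mult_left_mono mult_right_mono power_le_one) auto
  finally show ?thesis by (simp add: power_mult_distrib)
qed

text \<open>For small angles the cosine is near 1 and the sine is small, so the real part of the
  exponent dominates and pulls the mean of \<open>1 + cos\<close> down.\<close>

lemma char_contracts:
  assumes t: "0 \<le> t" "t * F \<le> 1 / 5" and \<theta>: "\<bar>\<theta>\<bar> \<le> 1 / 2"
  defines "z \<equiv> exp (- of_real t * levy_exponent \<nu> \<sigma>2 (1 / \<epsilon>))"
  shows "1 + cos \<theta> * Re z - sin \<theta> * Im z \<le> (1 - t * F / 12) * (1 + cos \<theta>)"
proof -
  let ?\<psi> = "levy_exponent \<nu> \<sigma>2 (1 / \<epsilon>)"
  have F: "0 \<le> F" by (rule levy_F_nonneg)
  have \<psi>: "11 / 24 * F \<le> Re ?\<psi>" "\<bar>Im ?\<psi>\<bar> \<le> F / 6"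
    using scaled_levy_exponent_bounds[of 1] by simp_all
  have sq: "\<theta>\<^sup>2 \<le> 1 / 4"
    using power_mono[OF \<theta>, of 2] by (simp add: power2_eq_square)
  have cos: "7 / 8 \<le> cos \<theta>" using one_minus_cos_le[of \<theta>] sq by linarith
  have "7 / 8 * (11 / 24 * F) \<le> cos \<theta> * Re ?\<psi>"
    using cos \<psi>(1) F by (intro mult_mono) auto
  moreover have "sin \<theta> * Im ?\<psi> \<le> 1 / 2 * (F / 6)"
  proof -
    have "\<bar>sin \<theta>\<bar> * \<bar>Im ?\<psi>\<bar> \<le> 1 / 2 * (F / 6)"
      by (rule mult_mono[OF order_trans[OF abs_sin_x_le_abs_x \<theta>] \<psi>(2)]) simp_all
    then show ?thesis unfolding abs_mult[symmetric] by linarith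
  qed
  \<comment> \<open>The number 7/8 * 11/24 - 1/12 exceeds 0.317. Of this, 3/4 * 1/5 = 0.15 pays for
    the quadratic error and 2/12 for the contraction since \<open>1 + cos \<theta> \<le> 2\<close>;
    the threshold 1/5 just fits.\<close>
  ultimately have "317 / 1000 * F \<le> cos \<theta> * Re ?\<psi> - sin \<theta> * Im ?\<psi>" using F by linarith
  then have 1: "t * (317 / 1000 * F) \<le> t * (cos \<theta> * Re ?\<psi> - sin \<theta> * Im ?\<psi>)"
    using t by (intro mult_left_mono)
  have tF: "0 \<le> t * F" using t F by simp
  have 2: "(t * F)\<^sup>2 \<le> t * F * (1 / 5)"
    unfolding power2_eq_square using t tF by (intro mult_left_mono)
  have 3: "t * F / 12 * (1 + cos \<theta>) \<le> t * F / 12 * 2"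
    using tF by (intro mult_left_mono) auto
  have "1 + cos \<theta> * Re z - sin \<theta> * Im z \<le> 1 + cos \<theta> - t * (cos \<theta> * Re ?\<psi> - sin \<theta> * Im ?\<psi>) + 3 / 4 * (t * F)\<^sup>2"
  proof -
    have "\<bar>(cos \<theta> * Re z - sin \<theta> * Im z) - (cos \<theta> - t * (cos \<theta> * Re ?\<psi> - sin \<theta> * Im ?\<psi>))\<bar> \<le> 3 / 4 * (t * F)\<^sup>2"
      unfolding z_def using t by (intro scaled_char_approx) auto
    then show ?thesis unfolding abs_le_iff by linarith
  qed
  also have "\<dots> \<le> 1 + cos \<theta> - t * F / 12 * (1 + cos \<theta>)"
    using 1 2 3 tF by linarith
  finally show ?thesis by (simp only: left_diff_distrib mult_1_left)
qed

text \<open>At \<open>cos \<theta> = - 1 / 2\<close> the left-hand side vanishes, so the drift of \<open>1 / 2 + cos\<close> must be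
  strictly positive there and beat the loss \<open>p\<close>; away from that point the factor
  \<open>1 - t F\<close> leaves ample room.\<close>

lemma char_expands:
  assumes t: "0 \<le> t" "t * F \<le> 1 / 100" and \<theta>: "- 1 / 2 \<le> cos \<theta>"
  defines "z \<equiv> exp (- of_real t * levy_exponent \<nu> \<sigma>2 (2 * pi / 9 / \<epsilon>))"
    and "p \<equiv> (t * F + 30 * (t * F)\<^sup>2) / 81"
  shows "(1 - t * F) * (1 / 2 + cos \<theta>) \<le> 1 / 2 + cos \<theta> * Re z - sin \<theta> * Im z - 3 / 2 * p"
proof -
  \<comment> \<open>The frequency at which the position \<open>3 * \<epsilon>\<close> has angle
    \<open>2 * pi / 3\<close>, the zero of \<open>1 / 2 + cos\<close>.\<close>
  define w where "w = 2 * pi / 9"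
  have w: "2 / 3 \<le> w" "w \<le> 8 / 9" using pi_ge_3 pi_less_4 by (simp_all add: w_def)
  let ?\<psi> = "levy_exponent \<nu> \<sigma>2 (w / \<epsilon>)"
  \<comment> \<open>The value of the test function. The drift splits into a multiple of
    \<open>s\<close>, absorbed by the factor \<open>1 - t * F\<close>, and the drift at
    \<open>s = 0\<close>.\<close>
  define s where "s = 1 / 2 + cos \<theta>"
  have s: "0 \<le> s" "cos \<theta> = s - 1 / 2" using \<theta> by (simp_all add: s_def)
  have F: "0 \<le> F" by (rule levy_F_nonneg)
  have \<psi>: "(w\<^sup>2 / 2 - w ^ 4 / 24) * F \<le> Re ?\<psi>" "Re ?\<psi> \<le> w\<^sup>2 / 2 * F" "\<bar>Im ?\<psi>\<bar> \<le> w ^ 3 / 6 * F"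
    using scaled_levy_exponent_bounds[of w] w by simp_all
  have w2: "4 / 9 \<le> w\<^sup>2" "w\<^sup>2 \<le> 64 / 81"
    using power_mono[of "2 / 3" w 2] power_mono[of w "8 / 9" 2] w by (simp_all add: power_divide)
  have "s * Re ?\<psi> \<le> s * F"
  proof -
    have "w\<^sup>2 / 2 * F \<le> 1 * F" using w2 F by (intro mult_right_mono) auto
    then show ?thesis using \<psi>(2) s by (intro mult_left_mono) auto
  qed
  moreover have "- (sin \<theta> * Im ?\<psi>) \<le> 1 * (w ^ 3 / 6 * F)"
  proof -
    have "\<bar>sin \<theta>\<bar> * \<bar>Im ?\<psi>\<bar> \<le> 1 * (w ^ 3 / 6 * F)"
      by (rule mult_mono[OF abs_sin_le_one \<psi>(3)]) simp_all
    then show ?thesis unfolding abs_mult[symmetric] by linarith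
  qed
  \<comment> \<open>The drift at \<open>s = 0\<close>, with \<open>w\<^sup>2\<close> factored out:
    the bracket is bounded at the largest \<open>w\<close>, 8/9, and the negative result multiplied
    by the smallest \<open>w\<^sup>2\<close>, 4/9.\<close>
  moreover have "w ^ 3 / 6 * F - (w\<^sup>2 / 2 - w ^ 4 / 24) * F / 2 \<le> - 37 / 1000 * F"
  proof -
    have "w\<^sup>2 * (w / 6 + w\<^sup>2 / 48 - 1 / 4) \<le> w\<^sup>2 * (- 21 / 250)"
      using w w2 by (intro mult_left_mono) auto
    also have "\<dots> \<le> - 37 / 1000" using w2 by simp
    finally have "w\<^sup>2 * (w / 6 + w\<^sup>2 / 48 - 1 / 4) * F \<le> - 37 / 1000 * F"
      using F by (intro mult_right_mono)
    then show ?thesis by (simp add: algebra_simps eval_nat_numeral)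
  qed
  ultimately have "cos \<theta> * Re ?\<psi> - sin \<theta> * Im ?\<psi> \<le> s * F - 37 / 1000 * F"
    using \<psi>(1) unfolding s(2) by (simp add: algebra_simps)
  then have 1: "t * (cos \<theta> * Re ?\<psi> - sin \<theta> * Im ?\<psi>) \<le> t * (s * F - 37 / 1000 * F)"
    using t by (intro mult_left_mono)
  have tF: "0 \<le> t * F" using t F by simp
  have 2: "(t * F)\<^sup>2 \<le> t * F * (1 / 100)"
    unfolding power2_eq_square using t tF by (intro mult_left_mono)
  \<comment> \<open>The budget is 0.037: at most 0.029 for the discarded steps and 3/4 * 1/100 =
    0.0075 for the quadratic error.\<close>
  have p: "3 / 2 * p \<le> 29 / 1000 * (t * F)" unfolding p_def using 2 tF by simp
  have z: "z = exp (- of_real t * ?\<psi>)" by (simp add: z_def w_def)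
  have "cos \<theta> * Re z - sin \<theta> * Im z \<ge> cos \<theta> - t * (cos \<theta> * Re ?\<psi> - sin \<theta> * Im ?\<psi>) - 3 / 4 * (t * F)\<^sup>2"
  proof -
    have "\<bar>(cos \<theta> * Re z - sin \<theta> * Im z) - (cos \<theta> - t * (cos \<theta> * Re ?\<psi> - sin \<theta> * Im ?\<psi>))\<bar> \<le> 3 / 4 * (t * F)\<^sup>2"
      unfolding z using t w by (intro scaled_char_approx) auto
    then show ?thesis unfolding abs_le_iff by linarith
  qed
  moreover have "(1 - t * F) * (1 / 2 + cos \<theta>) = s - t * (s * F)" by (simp add: s_def algebra_simps)
  moreover have "t * (s * F - 37 / 1000 * F) = t * (s * F) - 37 / 1000 * (t * F)" by (simp add: algebra_simps)
  ultimately show ?thesis using 1 2 p tF s(2) by linarith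
qed

end

section \<open>Random walks confined to an interval\<close>

locale independent_walk = prob_space M for M :: "'a measure" +
  fixes \<xi> :: "nat \<Rightarrow> 'a \<Rightarrow> real" and n :: nat
  assumes indep_steps: "indep_vars (\<lambda>_. borel) \<xi> {..<n}"
begin

definition walk :: "nat \<Rightarrow> 'a \<Rightarrow> real" where
  "walk k \<omega> = (\<Sum>i<k. \<xi> i \<omega>)"

definition confined :: "real \<Rightarrow> nat \<Rightarrow> 'a set" where
  "confined b k = {\<omega> \<in> space M. \<forall>j\<le>k. \<bar>walk j \<omega>\<bar> \<le> b}"

lemma walk_0 [simp]: "walk 0 \<omega> = 0"
  by (simp add: walk_def)

lemma walk_Suc: "walk (Suc k) \<omega> = walk k \<omega> + \<xi> k \<omega>"
  by (simp add: walk_def)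

lemma measurable_step: "k < n \<Longrightarrow> \<xi> k \<in> borel_measurable M"
  using indep_steps by (auto simp: indep_vars_def)

lemma measurable_walk: "k \<le> n \<Longrightarrow> walk k \<in> borel_measurable M"
  unfolding walk_def[abs_def] by (intro borel_measurable_sum measurable_step) auto

lemma sets_confined:
  assumes "k \<le> n"
  shows "confined b k \<in> events"
proof -
  have "confined b k = (\<Inter>j\<in>{..k}. {\<omega> \<in> space M. \<bar>walk j \<omega>\<bar> \<le> b})"
    by (auto simp: confined_def)
  also have "\<dots> \<in> events"
  proof (intro sets.finite_INT)
    fix j assume "j \<in> {..k}"
    then have [measurable]: "walk j \<in> borel_measurable M"
      using assms by (intro measurable_walk) auto
    show "{\<omega> \<in> space M. \<bar>walk j \<omega>\<bar> \<le> b} \<in> events" by measurable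
  qed auto
  finally show ?thesis .
qed

lemma confined_Suc:
  "\<omega> \<in> confined b (Suc k) \<longleftrightarrow> \<omega> \<in> confined b k \<and> \<bar>walk (Suc k) \<omega>\<bar> \<le> b"
  by (auto simp: confined_def le_Suc_eq)

lemma confinedD: "\<omega> \<in> confined b k \<Longrightarrow> \<bar>walk k \<omega>\<bar> \<le> b"
  by (auto simp: confined_def)

lemma integrable_confined:
  assumes "k \<le> n" and [measurable]: "f \<in> borel_measurable M" and "\<And>\<omega>. \<bar>f \<omega>\<bar> \<le> B"
  shows "integrable M (\<lambda>\<omega>. indicator (confined b k) \<omega> * f \<omega> :: real)"
proof (rule integrable_const_bound[where B="B"])
  have [measurable]: "confined b k \<in> events" using assms(1) by (rule sets_confined)
  show "(\<lambda>\<omega>. indicator (confined b k) \<omega> * f \<omega> :: real) \<in> borel_measurable M" by measurable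
  show "AE \<omega> in M. norm (indicator (confined b k) \<omega> * f \<omega>) \<le> B"
    using assms(3) order_trans[OF abs_ge_zero assms(3)] by (intro AE_I2) (auto simp: indicator_def)
qed

text \<open>Takes the place of conditioning on the past: confinement up to \<open>k\<close> and the
  position at \<open>k\<close> are functions of the steps before \<open>k\<close>, hence independent
  of step \<open>k\<close>.\<close>

lemma expectation_past_times_step:
  fixes f g :: "real \<Rightarrow> real"
  assumes k: "k < n"
    and [measurable]: "f \<in> borel_measurable borel" "g \<in> borel_measurable borel"
    and f: "\<And>x. \<bar>f x\<bar> \<le> B" and g: "\<And>x. \<bar>g x\<bar> \<le> C"
  shows "expectation (\<lambda>\<omega>. indicator (confined b k) \<omega> * (f (walk k \<omega>) * g (\<xi> k \<omega>)))
    = expectation (\<lambda>\<omega>. indicator (confined b k) \<omega> * f (walk k \<omega>)) * expectation (\<lambda>\<omega>. g (\<xi> k \<omega>))"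
proof -
  \<comment> \<open>The past as one measurable function on the product space of the first
    \<open>k\<close> steps, the form in which independence of disjoint blocks can be
    composed.\<close>
  define F where "F x = (if \<forall>j\<in>{..k}. \<bar>\<Sum>i<j. x i\<bar> \<le> b then f (\<Sum>i<k. x i) else 0)" for x :: "nat \<Rightarrow> real"
  have [measurable]: "(\<lambda>x. \<Sum>i<j. x i) \<in> borel_measurable (PiM {..<k} (\<lambda>_. borel :: real measure))"
    if "j \<in> {..k}" for j
    using that by (intro borel_measurable_sum measurable_component_singleton) auto
  have F [measurable]: "F \<in> borel_measurable (PiM {..<k} (\<lambda>_. borel))"
  proof -
    have "Measurable.pred (PiM {..<k} (\<lambda>_. borel)) (\<lambda>x. \<forall>j\<in>{..k}. \<bar>\<Sum>i<j. x i\<bar> \<le> b)"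
      by (intro pred_intros_finite) auto
    moreover have "(\<lambda>x. f (\<Sum>i<k. x i)) \<in> borel_measurable (PiM {..<k} (\<lambda>_. borel))"
      by measurable
    ultimately show ?thesis unfolding F_def by measurable
  qed
  have "indep_var (PiM {..<k} (\<lambda>_. borel)) (\<lambda>\<omega>. restrict (\<lambda>i. \<xi> i \<omega>) {..<k})
      (PiM {k} (\<lambda>_. borel)) (\<lambda>\<omega>. restrict (\<lambda>i. \<xi> i \<omega>) {k})"
    using k by (intro indep_var_restrict[OF indep_steps]) auto
  then have "indep_var borel (F \<circ> (\<lambda>\<omega>. restrict (\<lambda>i. \<xi> i \<omega>) {..<k}))
      borel ((\<lambda>x. g (x k)) \<circ> (\<lambda>\<omega>. restrict (\<lambda>i. \<xi> i \<omega>) {k}))"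
    by (rule indep_var_compose) (simp_all add: F)
  moreover have sum: "(\<Sum>i<j. restrict (\<lambda>i. \<xi> i \<omega>) {..<k} i) = walk j \<omega>" if "j \<le> k" for j \<omega>
    using that by (auto simp: walk_def intro!: sum.cong)
  moreover have "F (restrict (\<lambda>i. \<xi> i \<omega>) {..<k}) = indicator (confined b k) \<omega> * f (walk k \<omega>)"
    if "\<omega> \<in> space M" for \<omega>
    unfolding F_def using sum that by (auto simp: confined_def indicator_def)
  ultimately have ind: "indep_var borel (\<lambda>\<omega>. F (restrict (\<lambda>i. \<xi> i \<omega>) {..<k})) borel (\<lambda>\<omega>. g (\<xi> k \<omega>))"
    and eq: "\<And>\<omega>. \<omega> \<in> space M \<Longrightarrow>
      F (restrict (\<lambda>i. \<xi> i \<omega>) {..<k}) = indicator (confined b k) \<omega> * f (walk k \<omega>)"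
    by (simp_all add: o_def)
  have [measurable]: "\<xi> k \<in> borel_measurable M" "walk k \<in> borel_measurable M"
    using k by (auto intro: measurable_step measurable_walk)
  have "integrable M (\<lambda>\<omega>. indicator (confined b k) \<omega> * f (walk k \<omega>))"
    using k f by (intro integrable_confined[where B=B]) auto
  then have "integrable M (\<lambda>\<omega>. F (restrict (\<lambda>i. \<xi> i \<omega>) {..<k}))"
    by (subst Bochner_Integration.integrable_cong[OF refl eq])
  moreover have "integrable M (\<lambda>\<omega>. g (\<xi> k \<omega>))"
    using g by (intro integrable_const_bound[where B=C]) auto
  ultimately have "expectation (\<lambda>\<omega>. F (restrict (\<lambda>i. \<xi> i \<omega>) {..<k}) * g (\<xi> k \<omega>))
      = expectation (\<lambda>\<omega>. F (restrict (\<lambda>i. \<xi> i \<omega>) {..<k})) * expectation (\<lambda>\<omega>. g (\<xi> k \<omega>))"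
    by (rule indep_var_lebesgue_integral[OF ind])
  then show ?thesis
    using eq by (simp add: mult.assoc cong: Bochner_Integration.integral_cong)
qed

text \<open>The addition theorem separates position and step into two products, and independence
  factors the mean of each.\<close>

lemma expectation_cos_step:
  assumes k: "k < n"
    and cr: "expectation (\<lambda>\<omega>. cos (u * \<xi> k \<omega>)) = cr"
    and ci: "expectation (\<lambda>\<omega>. sin (u * \<xi> k \<omega>)) = ci"
  shows "expectation (\<lambda>\<omega>. indicator (confined b k) \<omega> * (c + cos (u * walk (Suc k) \<omega>)))
    = expectation (\<lambda>\<omega>. indicator (confined b k) \<omega> * (c + cos (u * walk k \<omega>) * cr - sin (u * walk k \<omega>) * ci))"
    (is "?L = ?R")
proof -
  have [measurable]: "\<xi> k \<in> borel_measurable M" "walk k \<in> borel_measurable M"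
    using k by (auto intro: measurable_step measurable_walk)
  let ?I = "\<lambda>\<omega>. indicator (confined b k) \<omega> :: real"
  have b: "\<bar>cos x * cos y\<bar> \<le> 1" "\<bar>sin x * sin y\<bar> \<le> 1" for x y :: real
    by (auto simp: abs_mult mult_le_one)
  note int = integrable_confined[OF less_imp_le[OF k]]
  have int_c: "integrable M (\<lambda>\<omega>. ?I \<omega> * c)"
    by (rule int[where B="\<bar>c\<bar>"]) auto
  have int_cos: "integrable M (\<lambda>\<omega>. ?I \<omega> * (cos (u * walk k \<omega>) * cos (u * \<xi> k \<omega>)))"
    and int_sin: "integrable M (\<lambda>\<omega>. ?I \<omega> * (sin (u * walk k \<omega>) * sin (u * \<xi> k \<omega>)))"
    by (rule int[where B=1]; simp add: b)+
  have int_cr: "integrable M (\<lambda>\<omega>. ?I \<omega> * cos (u * walk k \<omega>) * cr)"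
    and int_ci: "integrable M (\<lambda>\<omega>. ?I \<omega> * sin (u * walk k \<omega>) * ci)"
    by (rule integrable_mult_left[OF int[where B=1]]; simp)+
  have "?L = expectation (\<lambda>\<omega>. ?I \<omega> * c + ?I \<omega> * (cos (u * walk k \<omega>) * cos (u * \<xi> k \<omega>))
      - ?I \<omega> * (sin (u * walk k \<omega>) * sin (u * \<xi> k \<omega>)))"
    by (intro Bochner_Integration.integral_cong) (simp_all add: walk_Suc cos_add algebra_simps)
  also have "\<dots> = expectation (\<lambda>\<omega>. ?I \<omega> * c) + expectation (\<lambda>\<omega>. ?I \<omega> * (cos (u * walk k \<omega>) * cos (u * \<xi> k \<omega>)))
      - expectation (\<lambda>\<omega>. ?I \<omega> * (sin (u * walk k \<omega>) * sin (u * \<xi> k \<omega>)))"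
    by (simp only: Bochner_Integration.integral_diff Bochner_Integration.integral_add
        Bochner_Integration.integrable_add int_c int_cos int_sin)
  also have "expectation (\<lambda>\<omega>. ?I \<omega> * (cos (u * walk k \<omega>) * cos (u * \<xi> k \<omega>)))
      = expectation (\<lambda>\<omega>. ?I \<omega> * cos (u * walk k \<omega>)) * cr"
    unfolding cr[symmetric]
    by (rule expectation_past_times_step[OF k, where B=1 and C=1 and f="\<lambda>x. cos (u * x)" and g="\<lambda>x. cos (u * x)"]) auto
  also have "expectation (\<lambda>\<omega>. ?I \<omega> * (sin (u * walk k \<omega>) * sin (u * \<xi> k \<omega>)))
      = expectation (\<lambda>\<omega>. ?I \<omega> * sin (u * walk k \<omega>)) * ci"
    unfolding ci[symmetric]
    by (rule expectation_past_times_step[OF k, where B=1 and C=1 and f="\<lambda>x. sin (u * x)" and g="\<lambda>x. sin (u * x)"]) auto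
  also have "expectation (\<lambda>\<omega>. ?I \<omega> * c) + expectation (\<lambda>\<omega>. ?I \<omega> * cos (u * walk k \<omega>)) * cr
      - expectation (\<lambda>\<omega>. ?I \<omega> * sin (u * walk k \<omega>)) * ci
    = expectation (\<lambda>\<omega>. ?I \<omega> * c + ?I \<omega> * cos (u * walk k \<omega>) * cr - ?I \<omega> * sin (u * walk k \<omega>) * ci)"
    by (simp only: Bochner_Integration.integral_diff Bochner_Integration.integral_add
        Bochner_Integration.integrable_add int_c int_cr int_ci integral_mult_left_zero)
  also have "\<dots> = ?R"
    by (intro Bochner_Integration.integral_cong) (auto simp: algebra_simps)
  finally show ?thesis .
qed

text \<open>The mean of \<open>1 + cos\<close> over confined paths starts at most at 2 and contracts
  by \<open>q\<close> in each step.\<close>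

lemma prob_confined_le:
  assumes cr: "\<And>k. k < n \<Longrightarrow> expectation (\<lambda>\<omega>. cos (u * \<xi> k \<omega>)) = cr"
    and ci: "\<And>k. k < n \<Longrightarrow> expectation (\<lambda>\<omega>. sin (u * \<xi> k \<omega>)) = ci"
    and contract: "\<And>x. \<bar>x\<bar> \<le> b \<Longrightarrow> 1 + cos (u * x) * cr - sin (u * x) * ci \<le> q * (1 + cos (u * x))"
    and cos_ge: "\<And>x. \<bar>x\<bar> \<le> b \<Longrightarrow> 0 \<le> cos (u * x)"
    and "0 \<le> q"
  shows "prob (confined b n) \<le> 2 * q ^ n"
proof -
  let ?e = "\<lambda>k. expectation (\<lambda>\<omega>. indicator (confined b k) \<omega> * (1 + cos (u * walk k \<omega>)))"
  have bd: "\<bar>1 + cos x\<bar> \<le> 2" for x :: real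
    using cos_le_one[of x] cos_ge_minus_one[of x] by linarith
  have "?e k \<le> 2 * q ^ k" if "k \<le> n" for k
    using that
  proof (induction k)
    case 0
    have "?e 0 \<le> expectation (\<lambda>\<omega>. 2)"
      by (intro integral_mono integrable_confined[where B=2]) (auto simp: indicator_def bd)
    then show ?case by simp
  next
    case (Suc k)
    then have k: "k < n" "k \<le> n" by auto
    have [measurable]: "walk k \<in> borel_measurable M" "walk (Suc k) \<in> borel_measurable M"
      using Suc.prems by (auto intro!: measurable_walk)
    \<comment> \<open>The test function is nonnegative, so dropping the constraint on the newest
      position can only increase the mean; the remaining event depends on the past alone.\<close>
    have "?e (Suc k) \<le> expectation (\<lambda>\<omega>. indicator (confined b k) \<omega> * (1 + cos (u * walk (Suc k) \<omega>)))"
    proof (intro integral_mono integrable_confined[where B=2])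
      show "indicator (confined b (Suc k)) \<omega> * (1 + cos (u * walk (Suc k) \<omega>))
        \<le> indicator (confined b k) \<omega> * (1 + cos (u * walk (Suc k) \<omega>))" for \<omega>
      proof -
        have "0 \<le> 1 + cos (u * walk (Suc k) \<omega>)"
          using cos_ge_minus_one[of "u * walk (Suc k) \<omega>"] by linarith
        then show ?thesis by (auto simp: indicator_def confined_Suc)
      qed
    qed (use Suc.prems in \<open>auto simp: bd\<close>)
    also have "\<dots> = expectation (\<lambda>\<omega>. indicator (confined b k) \<omega> *
        (1 + cos (u * walk k \<omega>) * cr - sin (u * walk k \<omega>) * ci))"
      using cr[OF k(1)] ci[OF k(1)] by (rule expectation_cos_step[OF k(1)])
    also have "\<dots> \<le> expectation (\<lambda>\<omega>. q * (indicator (confined b k) \<omega> * (1 + cos (u * walk k \<omega>))))"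
    proof (intro integral_mono)
      have "\<bar>1 + cos x * cr - sin x * ci\<bar> \<le> 1 + \<bar>cr\<bar> + \<bar>ci\<bar>" for x :: real
      proof -
        have "\<bar>cos x * cr\<bar> \<le> 1 * \<bar>cr\<bar>" "\<bar>sin x * ci\<bar> \<le> 1 * \<bar>ci\<bar>"
          unfolding abs_mult by (intro mult_right_mono; simp)+
        then show ?thesis by linarith
      qed
      then show "integrable M (\<lambda>\<omega>. indicator (confined b k) \<omega> * (1 + cos (u * walk k \<omega>) * cr - sin (u * walk k \<omega>) * ci))"
        using k by (intro integrable_confined) auto
      show "integrable M (\<lambda>\<omega>. q * (indicator (confined b k) \<omega> * (1 + cos (u * walk k \<omega>))))"
        using k by (intro integrable_mult_right integrable_confined[where B=2]) (auto simp: bd)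
      show "indicator (confined b k) \<omega> * (1 + cos (u * walk k \<omega>) * cr - sin (u * walk k \<omega>) * ci)
        \<le> q * (indicator (confined b k) \<omega> * (1 + cos (u * walk k \<omega>)))" for \<omega>
        using contract[OF confinedD[of \<omega>]] by (auto simp: indicator_def)
    qed
    also have "\<dots> = q * ?e k" by simp
    also have "\<dots> \<le> q * (2 * q ^ k)"
      using Suc.IH k \<open>0 \<le> q\<close> by (intro mult_left_mono) auto
    finally show ?case by simp
  qed
  then have "?e n \<le> 2 * q ^ n" by simp
  \<comment> \<open>Inside the interval the cosine is nonnegative, so the test function is at least
    1 there.\<close>
  moreover have "prob (confined b n) \<le> ?e n"
  proof -
    have [measurable]: "confined b n \<in> events" "walk n \<in> borel_measurable M"
      by (auto intro: sets_confined measurable_walk)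
    have "prob (confined b n) = expectation (\<lambda>\<omega>. indicator (confined b n) \<omega>)" by simp
    also have "\<dots> \<le> ?e n"
    proof (intro integral_mono integrable_confined[where B=2])
      show "indicator (confined b n) \<omega> \<le> indicator (confined b n) \<omega> * (1 + cos (u * walk n \<omega>))" for \<omega>
        using cos_ge[OF confinedD[of \<omega> b n]] by (auto simp: indicator_def)
      show "integrable M (\<lambda>\<omega>. indicator (confined b n) \<omega> :: real)"
        by (simp add: integrable_indicator_iff emeasure_eq_measure)
    qed (auto simp: bd)
    finally show ?thesis .
  qed
  ultimately show ?thesis by linarith
qed

text \<open>A step of size below \<open>b\<close> cannot leave the region where \<open>1 / 2 + cos (u x)\<close> is
  nonpositive once it has left \<open>[-b, b]\<close>: the positive part of that function is lost only
  through steps of size at least \<open>b\<close>.\<close>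

lemma prob_confined_ge:
  assumes cr: "\<And>k. k < n \<Longrightarrow> expectation (\<lambda>\<omega>. cos (u * \<xi> k \<omega>)) = cr"
    and ci: "\<And>k. k < n \<Longrightarrow> expectation (\<lambda>\<omega>. sin (u * \<xi> k \<omega>)) = ci"
    and big: "\<And>k. k < n \<Longrightarrow> prob {\<omega> \<in> space M. b \<le> \<bar>\<xi> k \<omega>\<bar>} \<le> p"
    and contract: "\<And>x. \<bar>x\<bar> \<le> b \<Longrightarrow>
      q * (1 / 2 + cos (u * x)) \<le> 1 / 2 + cos (u * x) * cr - sin (u * x) * ci - 3 / 2 * p"
    and b: "0 < b" "u * b = 2 * pi / 3"
    and "0 \<le> q"
  shows "q ^ n \<le> prob (confined b n)"
proof -
  let ?h = "\<lambda>x. 1 / 2 + cos (u * x)"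
  let ?I = "\<lambda>k \<omega>. indicator (confined b k) \<omega> :: real"
  let ?e = "\<lambda>k. expectation (\<lambda>\<omega>. ?I k \<omega> * ?h (walk k \<omega>))"
  have "0 < u * b" unfolding b(2) by simp
  then have u: "0 < u" using b(1) by (simp add: zero_less_mult_iff)
  have bd: "\<bar>1 / 2 + cos x\<bar> \<le> 2" "1 / 2 + cos x \<le> 3 / 2" for x :: real
    using cos_le_one[of x] cos_ge_minus_one[of x] by linarith+
  \<comment> \<open>3/2 is both the initial value and the maximum of the test function, so it
    cancels when the final mean is compared with the probability.\<close>
  have "3 / 2 * q ^ k \<le> ?e k" if "k \<le> n" for k
    using that
  proof (induction k)
    case 0
    have "?e 0 = expectation (\<lambda>\<omega>. 3 / 2)"
      using b by (intro Bochner_Integration.integral_cong) (auto simp: confined_def indicator_def)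
    then show ?case by (simp add: prob_space)
  next
    case (Suc k)
    then have k: "k < n" "k \<le> n" by auto
    have [measurable]: "walk k \<in> borel_measurable M" "walk (Suc k) \<in> borel_measurable M"
        "\<xi> k \<in> borel_measurable M" "confined b k \<in> events"
      using Suc.prems by (auto intro!: measurable_walk measurable_step sets_confined)
    let ?J = "\<lambda>\<omega>. indicator {x :: real. b \<le> \<bar>x\<bar>} (\<xi> k \<omega>) :: real"
    have J: "expectation (\<lambda>\<omega>. ?I k \<omega> * (1 * ?J \<omega>)) \<le> expectation (\<lambda>\<omega>. ?I k \<omega> * 1) * p"
    proof -
      have "expectation ?J = prob {\<omega> \<in> space M. b \<le> \<bar>\<xi> k \<omega>\<bar>}"
      proof -
        have "expectation ?J = expectation (indicator {\<omega> \<in> space M. b \<le> \<bar>\<xi> k \<omega>\<bar>})"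
          by (intro Bochner_Integration.integral_cong) (auto simp: indicator_def)
        also have "\<dots> = prob {\<omega> \<in> space M. b \<le> \<bar>\<xi> k \<omega>\<bar>}"
          by (rule Bochner_Integration.integral_indicator[THEN trans]) (auto simp: Int_absorb2)
        finally show ?thesis .
      qed
      also note big[OF k(1)]
      finally have "expectation (\<lambda>\<omega>. ?I k \<omega> * 1) * expectation ?J \<le> expectation (\<lambda>\<omega>. ?I k \<omega> * 1) * p"
        by (intro mult_left_mono integral_nonneg_AE) auto
      moreover have "expectation (\<lambda>\<omega>. ?I k \<omega> * (1 * ?J \<omega>)) = expectation (\<lambda>\<omega>. ?I k \<omega> * 1) * expectation ?J"
        by (rule expectation_past_times_step[OF k(1), where B=1 and C=1 and f="\<lambda>_. 1"])
          (auto simp: indicator_def)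
      ultimately show ?thesis by simp
    qed
    have bd': "\<bar>1 / 2 + cos x * cr - sin x * ci\<bar> \<le> 1 + \<bar>cr\<bar> + \<bar>ci\<bar>" for x :: real
    proof -
      have "\<bar>cos x * cr\<bar> \<le> 1 * \<bar>cr\<bar>" "\<bar>sin x * ci\<bar> \<le> 1 * \<bar>ci\<bar>"
        unfolding abs_mult by (intro mult_right_mono; simp)+
      then show ?thesis by linarith
    qed
    have int: "integrable M (\<lambda>\<omega>. ?I k \<omega> * (1 / 2 + cos (u * walk k \<omega>) * cr - sin (u * walk k \<omega>) * ci))"
      using k bd' by (intro integrable_confined) auto
    have int1: "integrable M (\<lambda>\<omega>. ?I k \<omega> * 1)"
      using k by (intro integrable_confined[where B=1]) auto
    have intJ: "integrable M (\<lambda>\<omega>. ?I k \<omega> * (1 * ?J \<omega>))"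
      using k by (intro integrable_confined[where B=1]) (auto simp: indicator_def)
    have int': "integrable M (\<lambda>\<omega>. ?I k \<omega> * ?h (walk (Suc k) \<omega>))"
      using k bd by (intro integrable_confined[where B=2]) auto
    have "3 / 2 * q ^ Suc k = q * (3 / 2 * q ^ k)" by simp
    also have "\<dots> \<le> q * ?e k"
      using Suc.IH k \<open>0 \<le> q\<close> by (intro mult_left_mono) auto
    also have "\<dots> = expectation (\<lambda>\<omega>. q * (?I k \<omega> * ?h (walk k \<omega>)))" by simp
    also have "\<dots> \<le> expectation (\<lambda>\<omega>. ?I k \<omega> * (1 / 2 + cos (u * walk k \<omega>) * cr - sin (u * walk k \<omega>) * ci)
        - 3 / 2 * p * (?I k \<omega> * 1))"
    proof (intro integral_mono)
      show "integrable M (\<lambda>\<omega>. q * (?I k \<omega> * ?h (walk k \<omega>)))"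
        using k bd by (intro integrable_mult_right integrable_confined[where B=2]) auto
      show "integrable M (\<lambda>\<omega>. ?I k \<omega> * (1 / 2 + cos (u * walk k \<omega>) * cr - sin (u * walk k \<omega>) * ci)
        - 3 / 2 * p * (?I k \<omega> * 1))"
        using int int1 by (intro Bochner_Integration.integrable_diff integrable_mult_right)
      show "q * (?I k \<omega> * ?h (walk k \<omega>)) \<le> ?I k \<omega> * (1 / 2 + cos (u * walk k \<omega>) * cr - sin (u * walk k \<omega>) * ci)
        - 3 / 2 * p * (?I k \<omega> * 1)" for \<omega>
        using contract[OF confinedD[of \<omega>]] by (auto simp: indicator_def)
    qed
    also have "\<dots> = expectation (\<lambda>\<omega>. ?I k \<omega> * ?h (walk (Suc k) \<omega>)) - 3 / 2 * (expectation (\<lambda>\<omega>. ?I k \<omega> * 1) * p)"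
      unfolding Bochner_Integration.integral_diff[OF int integrable_mult_right[OF int1]]
        expectation_cos_step[OF k(1) cr[OF k(1)] ci[OF k(1)]] integral_mult_right_zero
      by (simp only: mult_ac)
    also have "\<dots> \<le> expectation (\<lambda>\<omega>. ?I k \<omega> * ?h (walk (Suc k) \<omega>)) - 3 / 2 * expectation (\<lambda>\<omega>. ?I k \<omega> * (1 * ?J \<omega>))"
      using J by linarith
    also have "\<dots> = expectation (\<lambda>\<omega>. ?I k \<omega> * ?h (walk (Suc k) \<omega>) - 3 / 2 * (?I k \<omega> * (1 * ?J \<omega>)))"
      unfolding Bochner_Integration.integral_diff[OF int' integrable_mult_right[OF intJ]]
        integral_mult_right_zero ..
    also have "\<dots> \<le> ?e (Suc k)"
    proof (intro integral_mono)
      show "integrable M (\<lambda>\<omega>. ?I k \<omega> * ?h (walk (Suc k) \<omega>) - 3 / 2 * (?I k \<omega> * (1 * ?J \<omega>)))"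
        using int' intJ by (intro Bochner_Integration.integrable_diff integrable_mult_right)
      show "integrable M (\<lambda>\<omega>. ?I (Suc k) \<omega> * ?h (walk (Suc k) \<omega>))"
        using Suc.prems bd by (intro integrable_confined[where B=2]) auto
      fix \<omega>
      let ?y = "walk (Suc k) \<omega>"
      have "?h ?y \<le> 0" if "\<bar>walk k \<omega>\<bar> \<le> b" "b < \<bar>?y\<bar>" "\<bar>\<xi> k \<omega>\<bar> < b"
      proof -
        \<comment> \<open>An exit by a step shorter than \<open>b\<close> lands between
          \<open>b\<close> and \<open>2 * b\<close>, at angles from \<open>2 * pi / 3\<close> to
          \<open>4 * pi / 3\<close>.\<close>
        have y: "\<bar>?y\<bar> \<le> 2 * b" using that by (simp add: walk_Suc)
        have "u * b \<le> u * \<bar>?y\<bar>" "u * \<bar>?y\<bar> \<le> u * (2 * b)"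
          using y u that by (auto intro: mult_left_mono)
        moreover have "u * (2 * b) = 4 * pi / 3" using b(2) by (simp only: mult.left_commute[of u])
        moreover have "\<bar>u * ?y\<bar> = u * \<bar>?y\<bar>" using u by (simp add: abs_mult)
        ultimately have "cos (u * ?y) \<le> - 1 / 2"
          using b(2) by (intro cos_le_minus_half) linarith+
        then show ?thesis by simp
      qed
      then show "?I k \<omega> * ?h ?y - 3 / 2 * (?I k \<omega> * (1 * ?J \<omega>)) \<le> ?I (Suc k) \<omega> * ?h ?y"
        using bd(2)[of "u * ?y"] confinedD[of \<omega> b k] by (auto simp: indicator_def confined_Suc)
    qed
    finally show ?case .
  qed
  then have "3 / 2 * q ^ n \<le> ?e n" by simp
  also have "?e n \<le> expectation (\<lambda>\<omega>. 3 / 2 * ?I n \<omega>)"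
  proof (intro integral_mono)
    have [measurable]: "confined b n \<in> events" "walk n \<in> borel_measurable M"
      by (auto intro: sets_confined measurable_walk)
    show "integrable M (\<lambda>\<omega>. ?I n \<omega> * ?h (walk n \<omega>))"
      using bd by (intro integrable_confined[where B=2]) auto
    show "integrable M (\<lambda>\<omega>. 3 / 2 * ?I n \<omega>)"
      by (intro integrable_mult_right) (auto simp: emeasure_eq_measure)
    show "?I n \<omega> * ?h (walk n \<omega>) \<le> 3 / 2 * ?I n \<omega>" for \<omega>
      using bd(2) by (auto simp: indicator_def)
  qed
  also have "\<dots> = 3 / 2 * prob (confined b n)"
    using sets_confined[of n b] sets.sets_into_space[OF sets_confined[of n b]] by (simp add: Int_absorb2)
  finally show ?thesis by simp
qed

end

section \<open>Discretised martingales\<close>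

context levy_martingale
begin

lemma small_jumps_if_concentrated:
  assumes "0 < \<epsilon>" "emeasure \<nu> (- {-\<epsilon>..\<epsilon>}) = 0"
  shows "small_jumps \<nu> \<sigma>2 \<epsilon>"
  using assms sigma2_nonneg sets_nu nu_integrable by unfold_locales

definition increment :: "nat \<Rightarrow> nat \<Rightarrow> 'a \<Rightarrow> real" where
  "increment n i \<omega> = X (real (Suc i) / real n) \<omega> - X (real i / real n) \<omega>"

lemma independent_walk_increment:
  assumes "0 < n"
  shows "independent_walk M (increment n) n"
proof
  show "indep_vars (\<lambda>_. borel) (increment n) {..<n}"
    unfolding increment_def[abs_def] using assms
    by (intro indep_increments) (auto intro: divide_strict_right_mono)
qed

lemma walk_increment:
  assumes "0 < n" "\<omega> \<in> space M"
  shows "independent_walk.walk (increment n) k \<omega> = X (real k / real n) \<omega>"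
proof -
  interpret independent_walk M "increment n" n
    using assms(1) by (rule independent_walk_increment)
  have "walk k \<omega> = X (real k / real n) \<omega> - X (real 0 / real n) \<omega>"
    unfolding walk_def increment_def by (rule sum_lessThan_telescope)
  then show ?thesis using start_zero[OF assms(2)] by simp
qed

lemma confined_increment:
  assumes "0 < n"
  shows "independent_walk.confined M (increment n) b n
    = {\<omega> \<in> space M. \<forall>j\<le>n. \<bar>X (real j / real n) \<omega>\<bar> \<le> b}"
  unfolding independent_walk.confined_def[OF independent_walk_increment[OF assms]]
  using walk_increment[OF assms] by auto

lemma measurable_increment:
  assumes "i < n"
  shows "increment n i \<in> borel_measurable M"
  unfolding increment_def[abs_def] using assms
  by (intro borel_measurable_diff random_variable_X) auto

text \<open>Stationarity moves the increment to the origin, where the process starts at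
  zero.\<close>

lemma char_increment:
  assumes "i < n"
  shows "expectation (\<lambda>\<omega>. exp (\<i> * of_real (u * increment n i \<omega>)))
    = exp (- of_real (1 / real n) * levy_exponent \<nu> \<sigma>2 u)"
proof -
  have n: "0 < n" using assms by simp
  have le: "real i / n + 1 / n \<le> 1" using assms by (simp add: field_simps)
  \<comment> \<open>The term \<open>0 + 1 / n\<close> stays unsimplified to match stationarity with
    starting time 0.\<close>
  have X [measurable]: "X (real i / n + 1 / n) \<in> borel_measurable M" "X (real i / n) \<in> borel_measurable M"
      "X (0 + 1 / n) \<in> borel_measurable M" "X 0 \<in> borel_measurable M"
    using le n assms by (auto intro!: random_variable_X)
  let ?g = "\<lambda>x :: real. exp (\<i> * of_real (u * x))"
  have "increment n i = (\<lambda>\<omega>. X (real i / n + 1 / n) \<omega> - X (real i / n) \<omega>)"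
    by (simp add: increment_def[abs_def] add_divide_distrib add.commute)
  then have "expectation (\<lambda>\<omega>. ?g (increment n i \<omega>))
      = (\<integral>x. ?g x \<partial>distr M borel (\<lambda>\<omega>. X (real i / n + 1 / n) \<omega> - X (real i / n) \<omega>))"
    by (simp add: integral_distr)
  also have "distr M borel (\<lambda>\<omega>. X (real i / n + 1 / n) \<omega> - X (real i / n) \<omega>)
      = distr M borel (\<lambda>\<omega>. X (0 + 1 / n) \<omega> - X 0 \<omega>)"
    using le n by (intro stationary_increments) auto
  also have "(\<integral>x. ?g x \<partial>\<dots>) = expectation (\<lambda>\<omega>. ?g (X (0 + 1 / n) \<omega> - X 0 \<omega>))"
    by (rule integral_distr) measurable
  also have "\<dots> = expectation (\<lambda>\<omega>. ?g (X (1 / n) \<omega>))"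
    by (intro Bochner_Integration.integral_cong) (simp_all add: start_zero)
  also have "\<dots> = exp (- of_real (1 / real n) * levy_exponent \<nu> \<sigma>2 u)"
    using n by (intro char_exponent) auto
  finally show ?thesis .
qed

lemma prob_grid_le:
  assumes \<epsilon>: "0 < \<epsilon>" "emeasure \<nu> (- {-\<epsilon>..\<epsilon>}) = 0"
    and n: "0 < n" "levy_F \<nu> \<sigma>2 \<epsilon> / n \<le> 1 / 5"
  shows "prob {\<omega> \<in> space M. \<forall>j\<le>n. \<bar>X (real j / real n) \<omega>\<bar> \<le> \<epsilon> / 2} \<le> 2 * exp (- levy_F \<nu> \<sigma>2 \<epsilon> / 12)"
proof -
  interpret small_jumps \<nu> \<sigma>2 \<epsilon> using \<epsilon> by (rule small_jumps_if_concentrated)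
  interpret independent_walk M "increment n" n using n(1) by (rule independent_walk_increment)
  let ?z = "exp (- of_real (1 / real n) * levy_exponent \<nu> \<sigma>2 (1 / \<epsilon>))"
  let ?q = "1 - 1 / n * F / 12"
  have q: "0 \<le> ?q" using n by simp
  have "prob (confined (\<epsilon> / 2) n) \<le> 2 * ?q ^ n"
  proof (rule prob_confined_le[where u="1 / \<epsilon>" and cr="Re ?z" and ci="Im ?z"])
    fix k assume k: "k < n"
    show "expectation (\<lambda>\<omega>. cos (1 / \<epsilon> * increment n k \<omega>)) = Re ?z"
      "expectation (\<lambda>\<omega>. sin (1 / \<epsilon> * increment n k \<omega>)) = Im ?z"
      unfolding expectation_cos[OF measurable_increment[OF k]] expectation_sin[OF measurable_increment[OF k]]
        char_increment[OF k] by simp_all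
  next
    fix x :: real assume "\<bar>x\<bar> \<le> \<epsilon> / 2"
    then have x: "\<bar>1 / \<epsilon> * x\<bar> \<le> 1 / 2" using \<epsilon>(1) by (simp add: abs_mult field_simps)
    show "1 + cos (1 / \<epsilon> * x) * Re ?z - sin (1 / \<epsilon> * x) * Im ?z \<le> ?q * (1 + cos (1 / \<epsilon> * x))"
      using n x by (intro char_contracts) auto
    show "0 \<le> cos (1 / \<epsilon> * x)"
      using x pi_ge_3 by (intro cos_ge_zero) linarith+
  qed (rule q)
  also have "?q ^ n \<le> exp (- (1 / n * F / 12)) ^ n"
    using q exp_ge_add_one_self[of "- (1 / n * F / 12)"] by (intro power_mono) auto
  also have "\<dots> = exp (- F / 12)"
    using n(1) by (simp flip: exp_of_nat_mult)
  finally show ?thesis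
    unfolding confined_increment[OF n(1)] by simp
qed

lemma prob_grid_ge:
  assumes \<epsilon>: "0 < \<epsilon>" "emeasure \<nu> (- {-\<epsilon>..\<epsilon>}) = 0"
    and n: "0 < n" "levy_F \<nu> \<sigma>2 \<epsilon> / n \<le> 1 / 100"
  shows "exp (- 2 * levy_F \<nu> \<sigma>2 \<epsilon>) \<le> prob {\<omega> \<in> space M. \<forall>j\<le>n. \<bar>X (real j / real n) \<omega>\<bar> \<le> 3 * \<epsilon>}"
proof -
  interpret small_jumps \<nu> \<sigma>2 \<epsilon> using \<epsilon> by (rule small_jumps_if_concentrated)
  interpret independent_walk M "increment n" n using n(1) by (rule independent_walk_increment)
  let ?u = "2 * pi / 9 / \<epsilon>"
  let ?z = "exp (- of_real (1 / real n) * levy_exponent \<nu> \<sigma>2 ?u)"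
  let ?x = "1 / n * F"
  let ?p = "(?x + 30 * ?x\<^sup>2) / 81"
  have x: "0 \<le> ?x" "?x \<le> 1 / 100" using n levy_F_nonneg by simp_all
  have "exp (- 2 * F) = exp (- 2 * ?x) ^ n"
    using n(1) by (simp flip: exp_of_nat_mult)
  also have "\<dots> \<le> (1 - ?x) ^ n"
  \<comment> \<open>For \<open>x \<le> 1 / 100\<close>,
    \<open>ln (1 - x) \<ge> - x - 2 * x\<^sup>2 \<ge> - 2 * x\<close>.\<close>
  proof (rule power_mono)
    have "2 * x\<^sup>2 \<le> x" if "0 \<le> x" "x \<le> 1 / 100" for x :: real
      using mult_right_mono[of "2 * x" 1 x] that by (simp add: power2_eq_square)
    from this[OF x] have "- 2 * ?x \<le> ln (1 - ?x)"
      using ln_one_minus_pos_lower_bound[of ?x] x by linarith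
    moreover have "0 < 1 - ?x" using x by linarith
    ultimately show "exp (- 2 * ?x) \<le> 1 - ?x" by (simp only: ln_ge_iff)
  qed simp
  also have "\<dots> \<le> prob (confined (3 * \<epsilon>) n)"
  proof (rule prob_confined_ge[where u="?u" and cr="Re ?z" and ci="Im ?z" and p="?p"])
    fix k assume k: "k < n"
    show "expectation (\<lambda>\<omega>. cos (?u * increment n k \<omega>)) = Re ?z"
      "expectation (\<lambda>\<omega>. sin (?u * increment n k \<omega>)) = Im ?z"
      unfolding expectation_cos[OF measurable_increment[OF k]] expectation_sin[OF measurable_increment[OF k]]
        char_increment[OF k] by simp_all
    have "prob {\<omega> \<in> space M. 3 * \<epsilon> \<le> \<bar>increment n k \<omega>\<bar>}
        \<le> (1 / real n * \<epsilon>\<^sup>2 * variance_rate + 30 * (1 / real n)\<^sup>2 * variance_rate\<^sup>2) / (3 * \<epsilon>) ^ 4"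
      using char_increment[OF k] \<epsilon>(1)
      by (intro prob_big_step_le prob_space_axioms measurable_increment[OF k]) auto
    also have "\<dots> = ?p"
    proof -
      have "(t * \<epsilon>\<^sup>2 * (\<epsilon>\<^sup>2 * f) + 30 * t\<^sup>2 * (\<epsilon>\<^sup>2 * f)\<^sup>2) / (3 * \<epsilon>) ^ 4 = (t * f + 30 * (t * f)\<^sup>2) / 81" for t f
        using \<epsilon>(1) by (simp add: field_simps eval_nat_numeral)
      then show ?thesis unfolding variance_rate_eq .
    qed
    finally show "prob {\<omega> \<in> space M. 3 * \<epsilon> \<le> \<bar>increment n k \<omega>\<bar>} \<le> ?p" .
  next
    fix y :: real assume y: "\<bar>y\<bar> \<le> 3 * \<epsilon>"
    have "\<bar>?u * y\<bar> = ?u * \<bar>y\<bar>" using \<epsilon>(1) by (simp add: abs_mult)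
    also have "\<dots> \<le> ?u * (3 * \<epsilon>)" using y \<epsilon>(1) by (intro mult_left_mono) auto
    also have "\<dots> = 2 * pi / 3" using \<epsilon>(1) by simp
    finally have "- 1 / 2 \<le> cos (?u * y)" by (rule cos_ge_minus_half)
    then show "(1 - ?x) * (1 / 2 + cos (?u * y)) \<le> 1 / 2 + cos (?u * y) * Re ?z - sin (?u * y) * Im ?z - 3 / 2 * ?p"
      using x by (intro char_expands) auto
  next
    show "0 \<le> 1 - ?x" using x by linarith
  qed (use \<epsilon>(1) in simp_all)
  finally show ?thesis
    unfolding confined_increment[OF n(1)] .
qed

section \<open>From the dyadic grids to the whole path\<close>

text \<open>Powers of two make the grids nested, so that these events decrease in
  \<open>m\<close>.\<close>

definition dyadic_confined :: "real \<Rightarrow> nat \<Rightarrow> 'a set" where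
  "dyadic_confined b m = {\<omega> \<in> space M. \<forall>j\<le>2 ^ m. \<bar>X (real j / 2 ^ m) \<omega>\<bar> \<le> b}"

lemma sets_dyadic_confined: "dyadic_confined b m \<in> events"
proof -
  have n: "(0 :: nat) < 2 ^ m" by simp
  have "{\<omega> \<in> space M. \<forall>j\<le>2 ^ m. \<bar>X (real j / real (2 ^ m)) \<omega>\<bar> \<le> b} \<in> events"
    unfolding confined_increment[OF n, symmetric]
    by (rule independent_walk.sets_confined[OF independent_walk_increment[OF n] order_refl])
  then show ?thesis by (simp only: dyadic_confined_def of_nat_power of_nat_numeral)
qed

lemma decseq_dyadic_confined: "decseq (dyadic_confined b)"
proof (rule decseq_SucI)
  fix m
  have "\<bar>X (real j / 2 ^ m) \<omega>\<bar> \<le> b"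
    if "\<omega> \<in> dyadic_confined b (Suc m)" "j \<le> 2 ^ m" for \<omega> j
  proof -
    have "\<forall>i\<le>2 ^ Suc m. \<bar>X (real i / 2 ^ Suc m) \<omega>\<bar> \<le> b"
      using that(1) by (simp add: dyadic_confined_def)
    moreover have "2 * j \<le> 2 ^ Suc m" using that(2) by simp
    ultimately have "\<bar>X (real (2 * j) / 2 ^ Suc m) \<omega>\<bar> \<le> b" by blast
    then show ?thesis by simp
  qed
  then show "dyadic_confined b (Suc m) \<subseteq> dyadic_confined b m"
    by (auto simp: dyadic_confined_def)
qed

lemma unit_sup_norm_event:
  "{\<omega> \<in> space M. unit_sup_norm (\<lambda>t. X t \<omega>) \<le> b} = (\<Inter>m. dyadic_confined b m)"
proof (rule set_eqI)
  fix \<omega>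
  show "\<omega> \<in> {\<omega> \<in> space M. unit_sup_norm (\<lambda>t. X t \<omega>) \<le> b} \<longleftrightarrow> \<omega> \<in> (\<Inter>m. dyadic_confined b m)"
    by (cases "\<omega> \<in> space M") (simp_all add: dyadic_confined_def unit_sup_norm_le_iff[OF cadlag_paths])
qed

lemma eventually_F_dyadic:
  assumes "0 < \<delta>"
  shows "\<forall>\<^sub>F m in sequentially. levy_F \<nu> \<sigma>2 \<epsilon> / real (2 ^ m) \<le> \<delta>"
proof -
  have "(\<lambda>m. levy_F \<nu> \<sigma>2 \<epsilon> * (1 / 2) ^ m) \<longlonglongrightarrow> levy_F \<nu> \<sigma>2 \<epsilon> * 0"
    by (intro tendsto_intros LIMSEQ_realpow_zero) auto
  then have "\<forall>\<^sub>F m in sequentially. levy_F \<nu> \<sigma>2 \<epsilon> * (1 / 2) ^ m < \<delta>"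
    using assms by (intro order_tendstoD) auto
  then show ?thesis by (rule eventually_mono) (simp add: power_divide)
qed

end

theorem proposition1p4:
  fixes M :: "'a measure" and X :: "real \<Rightarrow> 'a \<Rightarrow> real"
    and \<nu> :: "real measure" and \<sigma>2 \<epsilon> :: real
  assumes "\<epsilon> > 0"
    and "levy_martingale M X \<nu> \<sigma>2"
    and "\<not> deterministic M X"
    and "emeasure \<nu> (- {-\<epsilon>..\<epsilon>}) = 0"
  shows "measure M {\<omega> \<in> space M. unit_sup_norm (\<lambda>t. X t \<omega>) \<le> 3 * \<epsilon>}
           \<ge> exp (- 10 * levy_F \<nu> \<sigma>2 \<epsilon> - 3)
       \<and> measure M {\<omega> \<in> space M. unit_sup_norm (\<lambda>t. X t \<omega>) \<le> \<epsilon> / 2}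
           \<le> exp (- levy_F \<nu> \<sigma>2 \<epsilon> / 12 + 1)"
proof
  interpret levy_martingale M X \<nu> \<sigma>2 by fact
  interpret small_jumps \<nu> \<sigma>2 \<epsilon> using assms(1,4) by (rule small_jumps_if_concentrated)
  \<comment> \<open>Continuity from above: a lower bound valid on all fine grids survives in the
    limit.\<close>
  have "(\<lambda>m. prob (dyadic_confined (3 * \<epsilon>) m)) \<longlonglongrightarrow> prob (\<Inter>m. dyadic_confined (3 * \<epsilon>) m)"
    using sets_dyadic_confined decseq_dyadic_confined by (intro finite_Lim_measure_decseq) auto
  moreover have "\<forall>\<^sub>F m in sequentially. exp (- 2 * F) \<le> prob (dyadic_confined (3 * \<epsilon>) m)"
    using eventually_F_dyadic[of "1 / 100" \<epsilon>]
  proof (rule eventually_mono)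
    fix m :: nat assume m: "F / real (2 ^ m) \<le> 1 / 100"
    show "exp (- 2 * F) \<le> prob (dyadic_confined (3 * \<epsilon>) m)"
      using prob_grid_ge[OF assms(1,4) _ m] by (simp add: dyadic_confined_def)
  qed simp
  ultimately have "exp (- 2 * F) \<le> prob (\<Inter>m. dyadic_confined (3 * \<epsilon>) m)"
    by (rule tendsto_lowerbound) simp
  moreover have "exp (- 10 * F - 3) \<le> exp (- 2 * F)" using levy_F_nonneg by simp
  ultimately show "exp (- 10 * F - 3) \<le> prob {\<omega> \<in> space M. unit_sup_norm (\<lambda>t. X t \<omega>) \<le> 3 * \<epsilon>}"
    unfolding unit_sup_norm_event by linarith
  \<comment> \<open>For the upper bound a single fine grid suffices, because the intersection lies
    in each of its members.\<close>
  obtain m :: nat where m: "F / real (2 ^ m) \<le> 1 / 5"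
    using eventually_happens[OF eventually_F_dyadic[of "1 / 5" \<epsilon>]] by auto
  have "prob {\<omega> \<in> space M. unit_sup_norm (\<lambda>t. X t \<omega>) \<le> \<epsilon> / 2} \<le> prob (dyadic_confined (\<epsilon> / 2) m)"
    unfolding unit_sup_norm_event using sets_dyadic_confined by (intro finite_measure_mono) auto
  also have "\<dots> \<le> 2 * exp (- F / 12)"
    using prob_grid_le[OF assms(1,4) _ m] by (simp add: dyadic_confined_def)
  \<comment> \<open>The factor 2 is absorbed by \<open>exp 1\<close>, which accounts for the summand
    1 in the exponent.\<close>
  also have "\<dots> \<le> exp 1 * exp (- F / 12)"
    using exp_ge_add_one_self[of 1] by (intro mult_right_mono) simp_all
  also have "\<dots> = exp (- F / 12 + 1)" by (simp flip: exp_add)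
  finally show "prob {\<omega> \<in> space M. unit_sup_norm (\<lambda>t. X t \<omega>) \<le> \<epsilon> / 2} \<le> exp (- F / 12 + 1)" .
qed

end
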